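(* Let $\mathbb{K}$ be a field and let $B_1$ be the $\mathbb{K}$-algebra generated by $a_0,b_0,c_0,a_1,b_1,c_1$ subject to the relations $$a_1b_1c_1=0,\quad c_0a_0=0,\quad a_0b_0c_0+c_1a_1b_1=0,\quad b_1c_1a_1=0,\quad c_0c_1=0,\quad b_1a_0=0,$$ with the degree-lexicographic order on words determined by $a_1>b_1>c_1>a_0>b_0>c_0$. Let $d_n: C_n\otimes B_1\to C_{n-1}\otimes B_1$ ($n\ge 1$) be the differentials of Anick's resolution of $\mathbb{K}$ by free right $B_1$-modules, where $C_n$ is the span of the $n$-chains. For a word $w$ and $k\ge 0$ write $w^k$ for the $k$-fold concatenation ($w^0$ is the empty word). Then the differentials are given on the free generators as follows. If $n=2m+1$ with $m\ge 0$: $$d_n\big((a_1b_1c_1)^{m+1}\otimes 1\big)=(a_1b_1c_1)^{m}a_1\otimes b_1c_1,$$ $$d_n\big((c_1a_1b_1)^{m+1}\otimes 1\big)=(c_1a_1b_1)^{m}c_1\otimes a_1b_1+(c_1a_1b_1)^{m}a_0\otimes b_0c_0,$$ $$d_n\big((b_1c_1a_1)^{m+1}\otimes 1\big)=(b_1c_1a_1)^{m}b_1\otimes c_1a_1,$$ $$d_n\big((b_1c_1a_1)^{m}b_1a_0\otimes 1\big)=(b_1c_1a_1)^{m}b_1\otimes a_0,$$ $$d_n\big(c_0(c_1a_1b_1)^{m}c_1\otimes 1\big)=c_0(c_1a_1b_1)^{m}\otimes c_1,$$ $$d_n\big(c_0(c_1a_1b_1)^{m}a_0\otimes 1\big)=c_0(c_1a_1b_1)^{m}\otimes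 a_0.$$ If $n=2m$ with $m\ge 1$: $$d_n\big((a_1b_1c_1)^{m}a_1\otimes 1\big)=(a_1b_1c_1)^{m}\otimes a_1,$$ $$d_n\big((c_1a_1b_1)^{m}c_1\otimes 1\big)=(c_1a_1b_1)^{m}\otimes c_1,$$ $$d_n\big((c_1a_1b_1)^{m}a_0\otimes 1\big)=(c_1a_1b_1)^{m}\otimes a_0,$$ $$d_n\big((b_1c_1a_1)^{m}b_1\otimes 1\big)=(b_1c_1a_1)^{m}\otimes b_1+(b_1c_1a_1)^{m-1}b_1a_0\otimes b_0c_0,$$ $$d_n\big(c_0(c_1a_1b_1)^{m}\otimes 1\big)=c_0(c_1a_1b_1)^{m-1}c_1\otimes a_1b_1+c_0(c_1a_1b_1)^{m-1}a_0\otimes b_0c_0.$$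
   Context: Let $A=\mathbb{K}\langle X\mid R\rangle$ be a graded algebra with augmentation $\epsilon:A\to\mathbb{K}$ (killing all generators), with a fixed admissible order on words in $X$, reduced Gröbner basis $G$ of its ideal of relations, and set $F$ of leading words of $G$. A word is normal if it contains no element of $F$ as a subword; normal words form a basis of $A$, and elements of $A$ are identified with linear combinations of normal words. Chains. The only $(-1)$-chain is the empty word, which is its own tail. The $0$-chains are the elements of $X$, each its own tail. For $n\ge1$, an $n$-chain is a word $gt$, where $g$ is an $(n-1)$-chain with tail $r$, $t$ is a normal word, and $rt$ contains exactly one occurrence of an element of $F$ as a subword, located at the end of $rt$; the tail of $gt$ is $t$. $C_n$ is the $\mathbb{K}$-span of the $n$-chains ($C_{-1}=\mathbb{K}$). Anick's resolution. It is the sequence of free right $A$-modules $$\cdots\to C_n\otimes A\xrightarrow{d_n}C_{n-1}\otimes A\to\cdots\to C_0\otimes A\xrightarrow{d_0}C_{-1}\otimes A\xrightarrow{\epsilon}\mathbb{K}\to0,$$ where the right $A$-module maps $d_n$ and $\mathbb{K}$-linear maps $i_n:\ker d_{n-1}\to C_n\otimes A$ (with $d_{-1}=\epsilon$) are defined recursively by: (1) $d_0(x\otimes1)=1\otimes x$ for $x\in X$; (2) $i_0(1\otimes x_{j_1}x_{j_2}\cdots x_{j_k})=x_{j_1}\otimes x_{j_2}\cdots x_{j_k}$ for every nonempty normal word $x_{j_1}\cdots x_{j_k}$; (3) $d_{n+1}(gt\otimes1)=g\otimes t-i_nd_n(g\otimes t)$ for every $(n+1)$-chain $gt$ with tail $t$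 and $n$-chain $g$ ($n\ge0$); (4) for $n\ge1$, $i_n(0)=0$, and for $0\ne u\in\ker d_{n-1}$ with leading term $\alpha\, f\otimes s$ ($\alpha\in\mathbb{K}\setminus\{0\}$, $f$ an $(n-1)$-chain, $s$ a normal word), $i_n(u)=\alpha\,g\otimes c+i_n\big(u-\alpha\,d_n(g\otimes c)\big)$, where $g$ is the $n$-chain and $c$ the normal word with $fs=gc$ as words. Here the terms $f\otimes s$ ($f$ a chain, $s$ a normal word) are ordered by $f\otimes s<f'\otimes s'$ iff $fs<f's'$ in the order on words. For $B_1$ with the order above, the reduced Gröbner basis is the set of the six defining relations (up to normalization), so $F=\{a_1b_1c_1,\ c_0a_0,\ c_1a_1b_1,\ b_1c_1a_1,\ c_0c_1,\ b_1a_0\}$, and $c_1a_1b_1=-a_0b_0c_0$ in $B_1$. The $n$-chains for $n\ge 1$ are exactly the words appearing to the left of $\otimes\,1$ in the formulas of the claim. *)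

theory Defs
  imports Main "HOL-Library.Poly_Mapping" "HOL-Library.Sublist"
begin

text \<open>
  Words over \<open>'x\<close> are lists. With concatenation as the (additively written) monoid operation on
  lists, the convolution product on \<open>'x list \<Rightarrow>\<^sub>0 'k\<close> makes this type the free associative algebra
  \<open>'k\<langle>'x\<rangle>\<close>.
\<close>

instantiation list :: (type) monoid_add
begin

definition zero_list_def: "0 = []"
definition plus_list_def: "xs + ys = xs @ ys"

instance
  by standard (simp_all add: zero_list_def plus_list_def)

end

abbreviation mono_word :: "'x list \<Rightarrow> ('x list \<Rightarrow>\<^sub>0 'k::field)" where
  "mono_word w \<equiv> Poly_Mapping.single w 1"

definition scale :: "'k \<Rightarrow> ('b \<Rightarrow>\<^sub>0 'k) \<Rightarrow> ('b \<Rightarrow>\<^sub>0 'k::field)" where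
  "scale c p = Poly_Mapping.map ((*) c) p"

text \<open>The \<open>'k\<close>-linear map that takes the value \<open>h b\<close> on the basis vector \<open>b\<close>.\<close>

definition lin_ext :: "('b \<Rightarrow> ('c \<Rightarrow>\<^sub>0 'k)) \<Rightarrow> ('b \<Rightarrow>\<^sub>0 'k) \<Rightarrow> ('c \<Rightarrow>\<^sub>0 'k::field)" where
  "lin_ext h u = (\<Sum>b\<in>Poly_Mapping.keys u. scale (Poly_Mapping.lookup u b) (h b))"

inductive_set two_sided_ideal :: "('a::ring_1) set \<Rightarrow> 'a set" for R :: "'a set" where
  zero: "0 \<in> two_sided_ideal R"
| base: "r \<in> R \<Longrightarrow> r \<in> two_sided_ideal R"
| add: "p \<in> two_sided_ideal R \<Longrightarrow> q \<in> two_sided_ideal R \<Longrightarrow> p + q \<in> two_sided_ideal R"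
| mult_left: "p \<in> two_sided_ideal R \<Longrightarrow> a * p \<in> two_sided_ideal R"
| mult_right: "p \<in> two_sided_ideal R \<Longrightarrow> p * a \<in> two_sided_ideal R"

text \<open>
  The module \<open>C\<^sub>n \<otimes> A\<close> has as basis the terms \<open>f \<otimes> s\<close> with \<open>f\<close> an \<open>n\<close>-chain and \<open>s\<close> a normal word.
  Its elements are represented as finitely supported functions on pairs \<open>(f, s)\<close>. In particular,
  \<open>C\<^sub>-\<^sub>1 \<otimes> A\<close> is spanned by the pairs \<open>([], s)\<close>, since the empty word is the only chain of degree \<open>-1\<close>,
  and the unit of \<open>A\<close> is the empty word. The type does not enforce that \<open>f\<close> is a chain and that \<open>s\<close>
  is normal.
\<close>

type_synonym ('x, 'k) chain_module = "'x list \<times> 'x list \<Rightarrow>\<^sub>0 'k"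

definition term_tensor ::
    "'x list \<Rightarrow> 'x list \<Rightarrow> ('x, 'k::field) chain_module"  (infix "\<otimes>\<^sub>K" 75) where
  "f \<otimes>\<^sub>K s = Poly_Mapping.single (f, s) 1"

context
  fixes R :: "('x list \<Rightarrow>\<^sub>0 'k::field) set"
    and less_word :: "('x list \<times> 'x list) set"
begin

text \<open>
  Below, \<open>R\<close> is the set of defining relations and \<open>less_word\<close> the strict admissible order on words.
\<close>

definition leading_word :: "('x list \<Rightarrow>\<^sub>0 'k) \<Rightarrow> 'x list" where
  "leading_word p = (THE w. w \<in> Poly_Mapping.keys p \<and>
     (\<forall>v\<in>Poly_Mapping.keys p. v \<noteq> w \<longrightarrow> (v, w) \<in> less_word))"

definition is_reduced_groebner_basis :: "('x list \<Rightarrow>\<^sub>0 'k) set \<Rightarrow> bool" where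
  "is_reduced_groebner_basis G \<longleftrightarrow>
     G \<subseteq> two_sided_ideal R \<and> 0 \<notin> G \<and>
     (\<forall>p\<in>two_sided_ideal R. p \<noteq> 0 \<longrightarrow> (\<exists>g\<in>G. sublist (leading_word g) (leading_word p))) \<and>
     (\<forall>g\<in>G. Poly_Mapping.lookup g (leading_word g) = 1) \<and>
     (\<forall>g\<in>G. \<forall>h\<in>G. h \<noteq> g \<longrightarrow> (\<forall>w\<in>Poly_Mapping.keys g. \<not> sublist (leading_word h) w))"

definition reduced_groebner_basis :: "('x list \<Rightarrow>\<^sub>0 'k) set" where
  "reduced_groebner_basis = (THE G. is_reduced_groebner_basis G)"

definition obstructions :: "'x list set" where
  "obstructions = leading_word ` reduced_groebner_basis"

definition normal_word :: "'x list \<Rightarrow> bool" where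
  "normal_word w \<longleftrightarrow> \<not> (\<exists>f\<in>obstructions. sublist f w)"

text \<open>
  The quotient algebra \<open>A\<close> is identified with the span of the normal words; \<open>normal_form p\<close> is the
  class of \<open>p\<close> in \<open>A\<close>.
\<close>

definition normal_form :: "('x list \<Rightarrow>\<^sub>0 'k) \<Rightarrow> ('x list \<Rightarrow>\<^sub>0 'k)" where
  "normal_form p = (THE q. p - q \<in> two_sided_ideal R \<and> (\<forall>w\<in>Poly_Mapping.keys q. normal_word w))"

text \<open>
  \<open>tail_chain n w t\<close>: the word \<open>w\<close> is an \<open>n\<close>-chain (\<open>n \<ge> 0\<close>) with tail \<open>t\<close>. A triple \<open>(p, f, q)\<close> in
  \<open>occurrences w\<close> is an occurrence of \<open>f\<close> in \<open>w\<close>, located at the end of \<open>w\<close> iff \<open>q = []\<close>.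
\<close>

definition occurrences :: "'x list \<Rightarrow> ('x list \<times> 'x list \<times> 'x list) set" where
  "occurrences w = {(p, f, q). f \<in> obstructions \<and> w = p @ f @ q}"

inductive tail_chain :: "nat \<Rightarrow> 'x list \<Rightarrow> 'x list \<Rightarrow> bool" where
  generator: "tail_chain 0 [x] [x]"
| extend: "tail_chain n g r \<Longrightarrow> normal_word t \<Longrightarrow> occurrences (r @ t) = {(p, f, [])}
    \<Longrightarrow> tail_chain (Suc n) (g @ t) t"

definition anick_chain :: "nat \<Rightarrow> 'x list \<Rightarrow> bool" where
  "anick_chain n w \<longleftrightarrow> (\<exists>t. tail_chain n w t)"

definition tensor_elem :: "'x list \<Rightarrow> ('x list \<Rightarrow>\<^sub>0 'k) \<Rightarrow> ('x, 'k) chain_module" where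
  "tensor_elem f a = lin_ext (\<lambda>s. f \<otimes>\<^sub>K s) a"

definition right_action :: "('x, 'k) chain_module \<Rightarrow> ('x list \<Rightarrow>\<^sub>0 'k) \<Rightarrow> ('x, 'k) chain_module" where
  "right_action u a = lin_ext (\<lambda>(f, s). tensor_elem f (normal_form (mono_word s * a))) u"

text \<open>The right \<open>A\<close>-module map that takes the value \<open>h f\<close> on the free generator \<open>f \<otimes> 1\<close>.\<close>

definition module_ext ::
    "('x list \<Rightarrow> ('x, 'k) chain_module) \<Rightarrow> ('x, 'k) chain_module \<Rightarrow> ('x, 'k) chain_module" where
  "module_ext h u = lin_ext (\<lambda>(f, s). right_action (h f) (mono_word s)) u"

definition is_leading_term :: "('x, 'k) chain_module \<Rightarrow> 'x list \<Rightarrow> 'x list \<Rightarrow> bool" where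
  "is_leading_term u f s \<longleftrightarrow> (f, s) \<in> Poly_Mapping.keys u \<and>
     (\<forall>(f', s')\<in>Poly_Mapping.keys u. (f', s') \<noteq> (f, s) \<longrightarrow> (f' @ s', f @ s) \<in> less_word)"

text \<open>
  \<open>splitting_rel n D\<close> is the graph of the recursively defined map \<open>i\<^sub>n\<close> (\<open>n \<ge> 1\<close>), where \<open>D\<close> is the
  differential \<open>d\<^sub>n\<close>; \<open>splitting n D\<close> is the map \<open>i\<^sub>n\<close> itself. It is the splitting map of the
  resolution only on the kernel of \<open>d\<^sub>n\<^sub>-\<^sub>1\<close>, and the values elsewhere have no meaning.
\<close>

inductive splitting_rel ::
    "nat \<Rightarrow> (('x, 'k) chain_module \<Rightarrow> ('x, 'k) chain_module) \<Rightarrow>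
     ('x, 'k) chain_module \<Rightarrow> ('x, 'k) chain_module \<Rightarrow> bool"
  for n :: nat and D :: "('x, 'k) chain_module \<Rightarrow> ('x, 'k) chain_module" where
  zero: "splitting_rel n D 0 0"
| step: "is_leading_term u f s \<Longrightarrow> \<alpha> = Poly_Mapping.lookup u (f, s) \<Longrightarrow>
    anick_chain n g \<Longrightarrow> normal_word c \<Longrightarrow> f @ s = g @ c \<Longrightarrow>
    splitting_rel n D (u - scale \<alpha> (D (g \<otimes>\<^sub>K c))) v \<Longrightarrow>
    splitting_rel n D u (scale \<alpha> (g \<otimes>\<^sub>K c) + v)"

definition splitting ::
    "nat \<Rightarrow> (('x, 'k) chain_module \<Rightarrow> ('x, 'k) chain_module) \<Rightarrow>
     ('x, 'k) chain_module \<Rightarrow> ('x, 'k) chain_module" where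
  "splitting n D u =
     (if n = 0 then lin_ext (\<lambda>(f, s). case s of [] \<Rightarrow> 0 | x # s' \<Rightarrow> [x] \<otimes>\<^sub>K s') u
      else (THE v. splitting_rel n D u v))"

primrec anick_differential :: "nat \<Rightarrow> ('x, 'k) chain_module \<Rightarrow> ('x, 'k) chain_module" where
  "anick_differential 0 =
     module_ext (\<lambda>w. tensor_elem [] (normal_form (mono_word w)))"
| "anick_differential (Suc n) =
     module_ext (\<lambda>w.
       let (g, t) = (THE (g, t). w = g @ t \<and> anick_chain n g \<and> tail_chain (Suc n) w t)
       in g \<otimes>\<^sub>K t - splitting n (anick_differential n) (anick_differential n (g \<otimes>\<^sub>K t)))"

end

datatype B1_gen = A0 | B0 | C0 | A1 | B1 | C1

primrec B1_rank :: "B1_gen \<Rightarrow> nat" where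
  "B1_rank A1 = 5"
| "B1_rank B1 = 4"
| "B1_rank C1 = 3"
| "B1_rank A0 = 2"
| "B1_rank B0 = 1"
| "B1_rank C0 = 0"

definition B1_order :: "(B1_gen list \<times> B1_gen list) set" where
  "B1_order = lenlex {(x, y). B1_rank x < B1_rank y}"

definition B1_relations :: "(B1_gen list \<Rightarrow>\<^sub>0 'k::field) set" where
  "B1_relations =
     {mono_word [A1, B1, C1],
      mono_word [C0, A0],
      mono_word [A0, B0, C0] + mono_word [C1, A1, B1],
      mono_word [B1, C1, A1],
      mono_word [C0, C1],
      mono_word [B1, A0]}"

definition word_power :: "'x list \<Rightarrow> nat \<Rightarrow> 'x list"  (infixr "\<^bold>^" 80) where
  "w \<^bold>^ k = concat (replicate k w)"

end

theory Submission
  imports Defs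
begin

text \<open>
  In \<open>B\<^sub>1\<close> only one relation is not monomial: it rewrites \<open>c\<^sub>1a\<^sub>1b\<^sub>1\<close> to \<open>-a\<^sub>0b\<^sub>0c\<^sub>0\<close>, and every other leading
  word vanishes. In the step from degree \<open>n\<close> to \<open>n + 1\<close>, the value of the differential on a
  generator \<open>gt \<otimes> 1\<close> is \<open>g \<otimes> t\<close> minus the splitting of \<open>d\<^sub>n(g \<otimes> t)\<close>, and \<open>d\<^sub>n(g \<otimes> t)\<close> is obtained from
  \<open>d\<^sub>n(g \<otimes> 1)\<close> by multiplying the right tensor factors by \<open>t\<close>.
  Such a product either vanishes or is the rewriting of
  \<open>c\<^sub>1a\<^sub>1b\<^sub>1\<close>. In the first case \<open>d\<^sub>n\<^sub>+\<^sub>1(gt \<otimes> 1) = g \<otimes> t\<close>. In the second case the element to be split is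
  \<open>-f \<otimes> a\<^sub>0b\<^sub>0c\<^sub>0\<close>; since \<open>fa\<^sub>0\<close> is again an \<open>n\<close>-chain and \<open>d\<^sub>n(fa\<^sub>0 \<otimes> b\<^sub>0c\<^sub>0) = f \<otimes> a\<^sub>0b\<^sub>0c\<^sub>0\<close>, the recursion of
  the splitting stops after one step, and the correction term is \<open>fa\<^sub>0 \<otimes> b\<^sub>0c\<^sub>0\<close>. The lemmas
  \<open>B1_differential_extend\<close> and \<open>B1_differential_extend_correction\<close> state the two cases; the formulas
  follow by induction on the degree, in steps of two (\<open>odd_from_even\<close>, \<open>even_from_odd\<close>).

  Both the arithmetic of the algebra and the chains have to be known before this argument can start.
  The arithmetic comes from an action of the free algebra on the span of all words, in which a
  letter acts by concatenation followed by one rewriting step. The relations act as zero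
  (\<open>act_relation\<close>), so applying \<open>p\<close> to the empty word depends only on the class of \<open>p\<close>; the result is
  a combination of normal words congruent to \<open>p\<close>, so it is the normal form. The
  resolution of overlaps is contained in the vanishing of the relations, and an ideal element whose
  leading word is normal would have a nonzero normal form. It follows that the relations are a
  reduced Groebner basis, and reduced Groebner bases are unique.

  The chains are controlled by a finite table (\<open>next_tail\<close>) telling which tails can follow a given
  tail. Unfolding it gives the chains of each degree. It also shows that
  no chain is a proper prefix of another chain of the same degree, which makes the
  factorization \<open>w = gt\<close> and the chain \<open>g\<close> in each splitting step unique.
\<close>

section \<open>Linear maps on finitely supported functions\<close>

lemma lookup_scale [simp]: "Poly_Mapping.lookup (scale c p) k = c * Poly_Mapping.lookup p k"
  by (simp add: scale_def map.rep_eq when_def)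

lemma scale_zero_left [simp]: "scale 0 p = 0"
  and scale_zero_right [simp]: "scale c 0 = 0"
  and scale_one [simp]: "scale 1 p = p"
  and scale_minus_one [simp]: "scale (- 1) p = - p"
  and scale_minus_right [simp]: "scale c (- p) = - scale c p"
  and scale_scale [simp]: "scale c (scale d p) = scale (c * d) p"
  and scale_single [simp]: "scale c (Poly_Mapping.single k d) = Poly_Mapping.single k (c * d)"
  and scale_add_left: "scale (c + d) p = scale c p + scale d p"
  and scale_add_right: "scale c (p + q) = scale c p + scale c q"
  by (rule poly_mapping_eqI, simp add: algebra_simps lookup_add lookup_single when_def)+

lemma poly_mapping_single_induct [case_names zero add]:
  fixes P :: "('b \<Rightarrow>\<^sub>0 'k::field) \<Rightarrow> bool"
  assumes "P 0" and "\<And>b c u. P u \<Longrightarrow> P (Poly_Mapping.single b c + u)"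
  shows "P u"
proof (induction u rule: update_induct)
  case const
  show ?case by (fact assms(1))
next
  case (update f a b)
  have "Poly_Mapping.update a b f = Poly_Mapping.single a b + f"
    using update.hyps
    by (intro poly_mapping_eqI) (auto simp: lookup_update lookup_add lookup_single when_def in_keys_iff)
  then show ?case using assms(2) update.IH by simp
qed

lemma lin_ext_superset:
  assumes "finite K" "Poly_Mapping.keys u \<subseteq> K"
  shows "lin_ext h u = (\<Sum>b\<in>K. scale (Poly_Mapping.lookup u b) (h b))"
  unfolding lin_ext_def using assms
  by (intro sum.mono_neutral_left) (auto simp: in_keys_iff)

lemma lin_ext_zero [simp]: "lin_ext h 0 = 0"
  by (simp add: lin_ext_def)

lemma lin_ext_single [simp]: "lin_ext h (Poly_Mapping.single b c) = scale c (h b)"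
  by (cases "c = 0") (simp_all add: lin_ext_def)

lemma lin_ext_add: "lin_ext h (u + v) = lin_ext h u + lin_ext h v"
proof -
  let ?K = "Poly_Mapping.keys u \<union> Poly_Mapping.keys v"
  have "lin_ext h (u + v) = (\<Sum>b\<in>?K. scale (Poly_Mapping.lookup (u + v) b) (h b))"
    by (rule lin_ext_superset) (auto simp: keys_add)
  also have "\<dots> = lin_ext h u + lin_ext h v"
    by (simp add: lin_ext_superset[of ?K] lookup_add scale_add_left sum.distrib)
  finally show ?thesis .
qed

lemma lin_ext_scale: "lin_ext h (scale c u) = scale c (lin_ext h u)"
  by (induction u rule: poly_mapping_single_induct) (simp_all add: lin_ext_add scale_add_right)

lemma lin_ext_minus [simp]: "lin_ext h (- u) = - lin_ext h u"
  using lin_ext_scale[of h "- 1" u] by simp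

lemma lin_ext_diff: "lin_ext h (u - v) = lin_ext h u - lin_ext h v"
  using lin_ext_add[of h u "- v"] by simp

lemma lin_ext_cong_keys:
  "(\<And>b. b \<in> Poly_Mapping.keys u \<Longrightarrow> h b = h' b) \<Longrightarrow> lin_ext h u = lin_ext h' u"
  by (simp add: lin_ext_def)

lemma lin_ext_mono_word [simp]: "lin_ext (\<lambda>w. Poly_Mapping.single w 1) u = u"
  by (induction u rule: poly_mapping_single_induct) (simp_all add: lin_ext_add)

lemma keys_lin_extE:
  assumes "k \<in> Poly_Mapping.keys (lin_ext h u)"
  obtains b where "b \<in> Poly_Mapping.keys u" "k \<in> Poly_Mapping.keys (h b)"
proof -
  have "(\<Sum>b\<in>Poly_Mapping.keys u. Poly_Mapping.lookup u b * Poly_Mapping.lookup (h b) k) \<noteq> 0"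
    using assms by (simp add: in_keys_iff lin_ext_def lookup_sum)
  then obtain b where b: "b \<in> Poly_Mapping.keys u"
    "Poly_Mapping.lookup u b * Poly_Mapping.lookup (h b) k \<noteq> 0"
    by (meson sum.not_neutral_contains_not_neutral)
  show thesis by (rule that[of b]) (use b in \<open>auto simp: in_keys_iff\<close>)
qed

lemma two_sided_ideal_scale:
  fixes R :: "('x list \<Rightarrow>\<^sub>0 'k::field) set"
  assumes "p \<in> two_sided_ideal R"
  shows "scale c p \<in> two_sided_ideal R"
  using two_sided_ideal.mult_left[OF assms, of "Poly_Mapping.single 0 c"]
  by (simp add: scale_def mult_map_scale_conv_mult)

lemma two_sided_ideal_minus:
  fixes R :: "'a::ring_1 set"
  assumes "p \<in> two_sided_ideal R"
  shows "- p \<in> two_sided_ideal R"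
  using two_sided_ideal.mult_left[OF assms, of "- 1"] by simp

lemma two_sided_ideal_diff:
  fixes R :: "'a::ring_1 set"
  assumes "p \<in> two_sided_ideal R" "q \<in> two_sided_ideal R"
  shows "p - q \<in> two_sided_ideal R"
  using two_sided_ideal.add[OF assms(1) two_sided_ideal_minus[OF assms(2)]] by simp

section \<open>Uniqueness of reduced Groebner bases\<close>

text \<open>
  In an admissible order \<open>sublist_less\<close> follows from compatibility with multiplication and minimality
  of the empty word. It is the form in which the uniqueness of reduced bases uses the product of words:
  a proper divisor of a word is smaller than the word.
\<close>

locale word_order =
  fixes less_word :: "('x list \<times> 'x list) set"
  assumes trans_less: "trans less_word"
    and irrefl_less: "(w, w) \<notin> less_word"
    and total_less: "v \<noteq> w \<Longrightarrow> (v, w) \<in> less_word \<or> (w, v) \<in> less_word"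
    and sublist_less: "sublist v w \<Longrightarrow> v \<noteq> w \<Longrightarrow> (v, w) \<in> less_word"
begin

lemma less_asym: "(v, w) \<in> less_word \<Longrightarrow> (w, v) \<notin> less_word"
  using trans_less irrefl_less by (meson transD)

lemma finite_has_greatest:
  "finite K \<Longrightarrow> K \<noteq> {} \<Longrightarrow> \<exists>w\<in>K. \<forall>v\<in>K. v \<noteq> w \<longrightarrow> (v, w) \<in> less_word"
proof (induction K rule: finite_ne_induct)
  case (insert x K)
  then obtain w where w: "w \<in> K" "\<forall>v\<in>K. v \<noteq> w \<longrightarrow> (v, w) \<in> less_word" by auto
  have "x \<noteq> w" using insert w by auto
  then show ?case
    using total_less[of x w] w trans_less by (metis insert_iff transD)
qed simp

lemma leading_word_eqI:
  assumes "w \<in> Poly_Mapping.keys p"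
    and "\<And>v. v \<in> Poly_Mapping.keys p \<Longrightarrow> v \<noteq> w \<Longrightarrow> (v, w) \<in> less_word"
  shows "leading_word less_word p = w"
  unfolding leading_word_def
proof (rule the_equality)
  fix w' assume "w' \<in> Poly_Mapping.keys p \<and> (\<forall>v\<in>Poly_Mapping.keys p. v \<noteq> w' \<longrightarrow> (v, w') \<in> less_word)"
  then show "w' = w" using assms less_asym by metis
qed (use assms in auto)

lemma leading_word_greatest:
  assumes "p \<noteq> 0"
  shows "leading_word less_word p \<in> Poly_Mapping.keys p"
    and "v \<in> Poly_Mapping.keys p \<Longrightarrow> v \<noteq> leading_word less_word p \<Longrightarrow> (v, leading_word less_word p) \<in> less_word"
proof -
  obtain w where w: "w \<in> Poly_Mapping.keys p" "\<forall>v\<in>Poly_Mapping.keys p. v \<noteq> w \<longrightarrow> (v, w) \<in> less_word"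
    using finite_has_greatest[of "Poly_Mapping.keys p"] assms by auto
  then have "leading_word less_word p = w" by (intro leading_word_eqI) auto
  then show "leading_word less_word p \<in> Poly_Mapping.keys p"
    and "v \<in> Poly_Mapping.keys p \<Longrightarrow> v \<noteq> leading_word less_word p \<Longrightarrow> (v, leading_word less_word p) \<in> less_word"
    using w by auto
qed

text \<open>
  By divisibility in both directions, each \<open>g\<close> in one basis shares its leading word with some \<open>h\<close> in
  the other. Both are monic, so a nonzero \<open>g - h\<close> would have a smaller leading word, occurring in \<open>g\<close> or
  in \<open>h\<close> and divisible by a leading word of either basis. Reducedness forces that divisor to be the
  common leading word, which is larger than any of the other words of \<open>g\<close> and \<open>h\<close>.
\<close>

lemma reduced_groebner_basis_subset:
  fixes R :: "('x list \<Rightarrow>\<^sub>0 'k::field) set"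
  assumes G: "is_reduced_groebner_basis R less_word G"
    and H: "is_reduced_groebner_basis R less_word H"
  shows "G \<subseteq> H"
proof
  fix g assume g: "g \<in> G"
  let ?lw = "leading_word less_word :: ('x list \<Rightarrow>\<^sub>0 'k) \<Rightarrow> 'x list"
  note defs = is_reduced_groebner_basis_def
  have GI: "g \<in> two_sided_ideal R" "g \<noteq> 0" if "g \<in> G" for g using G that unfolding defs by auto
  have HI: "g \<in> two_sided_ideal R" "g \<noteq> 0" if "g \<in> H" for g using H that unfolding defs by auto
  have Gred: "g' = g" if "g \<in> G" "g' \<in> G" "w \<in> Poly_Mapping.keys g" "sublist (?lw g') w" for g g' w
    using G that unfolding defs by blast
  have Hred: "g' = g" if "g \<in> H" "g' \<in> H" "w \<in> Poly_Mapping.keys g" "sublist (?lw g') w" for g g' w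
    using H that unfolding defs by blast
  have Gdiv: "\<exists>g\<in>G. sublist (?lw g) (?lw p)" if "p \<in> two_sided_ideal R" "p \<noteq> 0" for p
    using G that unfolding defs by blast
  have Hdiv: "\<exists>g\<in>H. sublist (?lw g) (?lw p)" if "p \<in> two_sided_ideal R" "p \<noteq> 0" for p
    using H that unfolding defs by blast
  obtain h where h: "h \<in> H" "sublist (?lw h) (?lw g)" using Hdiv GI g by blast
  obtain g' where g': "g' \<in> G" "sublist (?lw g') (?lw h)" using Gdiv HI h by blast
  have "g' = g"
    using Gred[OF g g'(1) leading_word_greatest(1)[OF GI(2)[OF g]]] g'(2) h(2)
    by (meson sublist_order.order.trans)
  then have lw: "?lw h = ?lw g" using g'(2) h(2) by (simp add: sublist_order.order.antisym)
  have monic: "Poly_Mapping.lookup g (?lw g) = 1" "Poly_Mapping.lookup h (?lw g) = 1"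
    using G H g h(1) lw unfolding defs by metis+
  have "g - h = 0"
  proof (rule ccontr)
    assume nz: "g - h \<noteq> 0"
    let ?w = "?lw (g - h)"
    have I: "g - h \<in> two_sided_ideal R" using GI HI g h two_sided_ideal_diff by blast
    have wk: "?w \<in> Poly_Mapping.keys (g - h)" using leading_word_greatest(1)[OF nz] .
    then have ne: "?w \<noteq> ?lw g" using monic by (auto simp: in_keys_iff lookup_minus)
    have "?w \<in> Poly_Mapping.keys g \<or> ?w \<in> Poly_Mapping.keys h"
      using wk by (auto simp: in_keys_iff lookup_minus)
    then show False
    proof
      assume k: "?w \<in> Poly_Mapping.keys g"
      obtain g'' where "g'' \<in> G" "sublist (?lw g'') ?w" using Gdiv I nz by blast
      then have "sublist (?lw g) ?w" using Gred[OF g] k by metis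
      then show False
        using sublist_less[of "?lw g" ?w] leading_word_greatest(2)[OF GI(2)[OF g] k ne] ne less_asym
        by metis
    next
      assume k: "?w \<in> Poly_Mapping.keys h"
      obtain h'' where "h'' \<in> H" "sublist (?lw h'') ?w" using Hdiv I nz by blast
      then have "sublist (?lw h) ?w" using Hred[OF h(1)] k by metis
      then show False
        using sublist_less[of "?lw h" ?w] leading_word_greatest(2)[OF HI(2)[OF h(1)] k] ne less_asym lw
        by metis
    qed
  qed
  then show "g \<in> H" using h by simp
qed

lemma reduced_groebner_basis_eqI:
  "is_reduced_groebner_basis R less_word G \<Longrightarrow> reduced_groebner_basis R less_word = G"
  unfolding reduced_groebner_basis_def
  by (rule the_equality) (auto dest: reduced_groebner_basis_subset)

end

interpretation B1: word_order B1_order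
proof
  let ?r = "{(x, y). B1_rank x < B1_rank y}"
  have tr: "trans ?r" by (auto simp: trans_def)
  have inj: "x = y" if "B1_rank x = B1_rank y" for x y
    using that by (cases x; cases y; simp)
  have tot: "total ?r" using inj by (auto simp: total_on_def) (meson linorder_neqE_nat)
  show "trans B1_order" unfolding B1_order_def using tr by (rule lenlex_transI)
  show irr: "(w, w) \<notin> B1_order" for w
    unfolding B1_order_def by (rule lenlex_irreflexive) simp
  show "(v, w) \<in> B1_order \<or> (w, v) \<in> B1_order" if "v \<noteq> w" for v w
    using total_lenlex[OF tot] that by (auto simp: B1_order_def total_on_def)
  show "(v, w) \<in> B1_order" if "sublist v w" "v \<noteq> w" for v w
  proof -
    have "length v < length w"
      using that by (auto simp: sublist_def)
    then show ?thesis by (simp add: B1_order_def lenlex_conv)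
  qed
qed

section \<open>The normal form in the algebra\<close>

definition B1_leading_words :: "B1_gen list set" where
  "B1_leading_words = {[A1, B1, C1], [C0, A0], [C1, A1, B1], [B1, C1, A1], [C0, C1], [B1, A0]}"

definition B1_normal :: "B1_gen list \<Rightarrow> bool" where
  "B1_normal w \<longleftrightarrow> \<not> (\<exists>f\<in>B1_leading_words. sublist f w)"

lemma B1_normal_Nil [simp]: "B1_normal []"
  by (simp add: B1_normal_def B1_leading_words_def)

lemma B1_normal_Cons:
  "B1_normal (x # w) \<longleftrightarrow> (\<forall>f\<in>B1_leading_words. \<not> prefix f (x # w)) \<and> B1_normal w"
  by (auto simp: B1_normal_def sublist_Cons_right)

text \<open>
  Reduction of \<open>xw\<close> at its beginning only, which is a complete reduction when \<open>w\<close> is normal. The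
  definition makes sense for all words \<open>w\<close>, and the relations already hold for the resulting
  operators on the span of all words.
\<close>

definition left_mult :: "B1_gen \<Rightarrow> B1_gen list \<Rightarrow> (B1_gen list \<Rightarrow>\<^sub>0 'k::field)" where
  "left_mult x w =
     (if prefix [C1, A1, B1] (x # w) then - mono_word ([A0, B0, C0] @ drop 2 w)
      else if \<exists>f\<in>B1_leading_words. prefix f (x # w) then 0
      else mono_word (x # w))"

definition word_act :: "B1_gen list \<Rightarrow> (B1_gen list \<Rightarrow>\<^sub>0 'k::field) \<Rightarrow> (B1_gen list \<Rightarrow>\<^sub>0 'k)" where
  "word_act w = foldr (\<lambda>x. lin_ext (left_mult x)) w"

definition act :: "(B1_gen list \<Rightarrow>\<^sub>0 'k::field) \<Rightarrow> (B1_gen list \<Rightarrow>\<^sub>0 'k) \<Rightarrow> (B1_gen list \<Rightarrow>\<^sub>0 'k)" where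
  "act p v = lin_ext (\<lambda>w. word_act w v) p"

lemma word_act_simps [simp]:
  "word_act [] v = v" "word_act (x # w) v = lin_ext (left_mult x) (word_act w v)"
  "word_act (u @ w) v = word_act u (word_act w v)"
  by (simp_all add: word_act_def)

lemma word_act_add: "word_act w (u + v) = word_act w u + word_act w v"
  by (induction w) (simp_all add: lin_ext_add)

lemma word_act_scale: "word_act w (scale c v) = scale c (word_act w v)"
  by (induction w) (simp_all add: lin_ext_scale)

lemma word_act_zero [simp]: "word_act w 0 = 0"
  by (induction w) simp_all

lemma act_zero_left [simp]: "act 0 v = 0"
  and act_single: "act (Poly_Mapping.single w c) v = scale c (word_act w v)"
  and act_add_left: "act (p + q) v = act p v + act q v"
  by (simp_all add: act_def lin_ext_add)

lemma act_zero_right [simp]: "act p 0 = 0"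
  by (induction p rule: poly_mapping_single_induct) (simp_all add: act_single act_add_left)

lemma act_mult_single: "act (Poly_Mapping.single w c * q) v = scale c (word_act w (act q v))"
  by (induction q rule: poly_mapping_single_induct)
    (simp_all add: act_single act_add_left word_act_add word_act_scale scale_add_right
      distrib_left mult_single plus_list_def)

lemma act_mult: "act (p * q) v = act p (act q v)"
  by (induction p rule: poly_mapping_single_induct)
    (simp_all add: distrib_right act_mult_single act_single act_add_left)

lemma act_add_right: "act p (u + v) = act p u + act p v"
  by (induction p rule: poly_mapping_single_induct)
    (simp_all add: act_add_left act_single word_act_add scale_add_right)

lemma act_scale_right: "act p (scale c v) = scale c (act p v)"
  by (induction p rule: poly_mapping_single_induct)
    (simp_all add: act_add_left act_single word_act_scale scale_add_right mult.commute)

text \<open>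
  A letter rewrites only if it begins a leading word, so each case is decided by at most two letters
  of \<open>w\<close>.
\<close>

lemma left_mult_simps:
  "left_mult A0 w = mono_word (A0 # w)"
  "left_mult B0 w = mono_word (B0 # w)"
  "left_mult C0 w = (if prefix [A0] w \<or> prefix [C1] w then 0 else mono_word (C0 # w))"
  "left_mult A1 w = (if prefix [B1, C1] w then 0 else mono_word (A1 # w))"
  "left_mult B1 w = (if prefix [A0] w \<or> prefix [C1, A1] w then 0 else mono_word (B1 # w))"
  "left_mult C1 w = (if prefix [A1, B1] w then - mono_word ([A0, B0, C0] @ drop 2 w)
     else mono_word (C1 # w))"
  by (simp_all add: left_mult_def B1_leading_words_def)

text \<open>
  This is where the overlaps of the leading words are resolved. For example, \<open>b\<^sub>1\<close> acts after
  \<open>c\<^sub>1\<close> either on a word beginning with \<open>c\<^sub>1\<close>, or on one beginning with \<open>a\<^sub>0b\<^sub>0c\<^sub>0\<close>, and the latter is killed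
  because of \<open>b\<^sub>1a\<^sub>0 = 0\<close>.
\<close>

lemma word_act_relation_word:
  fixes w :: "B1_gen list"
  shows "word_act [A1, B1, C1] (mono_word w :: B1_gen list \<Rightarrow>\<^sub>0 'k::field) = 0"
    "word_act [C0, A0] (mono_word w :: B1_gen list \<Rightarrow>\<^sub>0 'k) = 0"
    "word_act [A0, B0, C0] (mono_word w) + word_act [C1, A1, B1] (mono_word w) = (0 :: B1_gen list \<Rightarrow>\<^sub>0 'k)"
    "word_act [B1, C1, A1] (mono_word w :: B1_gen list \<Rightarrow>\<^sub>0 'k) = 0"
    "word_act [C0, C1] (mono_word w :: B1_gen list \<Rightarrow>\<^sub>0 'k) = 0"
    "word_act [B1, A0] (mono_word w :: B1_gen list \<Rightarrow>\<^sub>0 'k) = 0"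
  by (auto simp: left_mult_simps prefix_def)

lemma act_relation:
  assumes "r \<in> (B1_relations :: (B1_gen list \<Rightarrow>\<^sub>0 'k::field) set)"
  shows "act r v = 0"
proof (induction v rule: poly_mapping_single_induct)
  case (add w c u)
  have "act r (mono_word w) = 0"
    using assms word_act_relation_word[of w, where 'k = 'k]
    by (auto simp: B1_relations_def act_add_left act_single simp del: word_act_simps)
  then show ?case using add act_scale_right[of r c "mono_word w"] by (simp add: act_add_right)
qed simp

lemma act_ideal: "p \<in> two_sided_ideal B1_relations \<Longrightarrow> act p v = 0"
  by (induction p arbitrary: v rule: two_sided_ideal.induct)
    (simp_all add: act_relation act_add_left act_mult)

definition B1_nf_word :: "B1_gen list \<Rightarrow> (B1_gen list \<Rightarrow>\<^sub>0 'k::field)" where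
  "B1_nf_word w = word_act w (mono_word [])"

definition B1_nf :: "(B1_gen list \<Rightarrow>\<^sub>0 'k::field) \<Rightarrow> (B1_gen list \<Rightarrow>\<^sub>0 'k)" where
  "B1_nf p = act p (mono_word [])"

lemma B1_nf_word_Nil [simp]: "B1_nf_word [] = mono_word []"
  and B1_nf_word_Cons: "B1_nf_word (x # w) = lin_ext (left_mult x) (B1_nf_word w)"
  by (simp_all add: B1_nf_word_def)

lemma B1_nf_conv: "B1_nf p = lin_ext B1_nf_word p"
  by (simp add: B1_nf_def act_def B1_nf_word_def[abs_def])

text \<open>
  Rewriting a prefix \<open>c\<^sub>1a\<^sub>1b\<^sub>1\<close> creates no new obstruction: \<open>a\<^sub>0\<close> and \<open>b\<^sub>0\<close> begin no
  leading word, the only ones that the new \<open>c\<^sub>0\<close> could begin are \<open>c\<^sub>0a\<^sub>0\<close> and \<open>c\<^sub>0c\<^sub>1\<close>, and then \<open>b\<^sub>1a\<^sub>0\<close> or \<open>a\<^sub>1b\<^sub>1c\<^sub>1\<close> would already occur in \<open>w\<close>.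
\<close>

lemma left_mult_normal:
  assumes "B1_normal w" and "v \<in> Poly_Mapping.keys (left_mult x w :: B1_gen list \<Rightarrow>\<^sub>0 'k::field)"
  shows "B1_normal v"
proof (cases "prefix [C1, A1, B1] (x # w)")
  case True
  then obtain u where u: "x = C1" "w = A1 # B1 # u" by (auto simp: prefix_def)
  then have "v = A0 # B0 # C0 # u" using assms(2) by (simp add: left_mult_def)
  then show ?thesis using assms(1) u
    by (auto simp: B1_normal_Cons B1_leading_words_def)
next
  case False
  then show ?thesis using assms
    by (auto simp: left_mult_def B1_normal_Cons split: if_splits)
qed

lemma B1_nf_word_keys_normal: "v \<in> Poly_Mapping.keys (B1_nf_word w :: B1_gen list \<Rightarrow>\<^sub>0 'k::field) \<Longrightarrow> B1_normal v"
proof (induction w arbitrary: v)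
  case (Cons x w)
  show ?case
    using Cons.prems unfolding B1_nf_word_Cons
    by (rule keys_lin_extE) (use Cons.IH left_mult_normal in metis)
qed simp

lemma B1_nf_keys_normal: "v \<in> Poly_Mapping.keys (B1_nf p) \<Longrightarrow> B1_normal v"
  unfolding B1_nf_conv by (erule keys_lin_extE) (rule B1_nf_word_keys_normal)

lemma B1_nf_word_normal: "B1_normal w \<Longrightarrow> B1_nf_word w = (mono_word w :: B1_gen list \<Rightarrow>\<^sub>0 'k::field)"
proof (induction w)
  case (Cons x w)
  then have "\<not> prefix [C1, A1, B1] (x # w)" by (auto simp: B1_normal_Cons B1_leading_words_def)
  with Cons show ?case by (auto simp: B1_nf_word_Cons left_mult_def B1_normal_Cons)
qed simp

lemma B1_nf_normal: "(\<And>w. w \<in> Poly_Mapping.keys p \<Longrightarrow> B1_normal w) \<Longrightarrow> B1_nf p = p"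
  using lin_ext_cong_keys[of p B1_nf_word "\<lambda>w. mono_word w"] by (simp add: B1_nf_conv B1_nf_word_normal)

lemma left_mult_congruent:
  "mono_word (x # w) - left_mult x w \<in> two_sided_ideal (B1_relations :: (B1_gen list \<Rightarrow>\<^sub>0 'k::field) set)"
  (is "_ \<in> ?I")
proof -
  have append: "mono_word (u @ v) = (mono_word u * mono_word v :: B1_gen list \<Rightarrow>\<^sub>0 'k)" for u v
    by (simp add: mult_single plus_list_def)
  consider (c1a1b1) u where "x # w = [C1, A1, B1] @ u"
    | (zero) f u where "\<not> prefix [C1, A1, B1] (x # w)" "f \<in> B1_leading_words" "x # w = f @ u"
    | (free) "\<forall>f\<in>B1_leading_words. \<not> prefix f (x # w)"
    unfolding prefix_def by blast
  then show ?thesis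
  proof cases
    case c1a1b1
    have "mono_word [A0, B0, C0] + mono_word [C1, A1, B1] \<in> ?I"
      by (rule two_sided_ideal.base) (simp add: B1_relations_def)
    from two_sided_ideal.mult_right[OF this, of "mono_word u"]
    show ?thesis using c1a1b1
      by (simp add: left_mult_def distrib_right add.commute flip: append)
  next
    case zero
    have "mono_word f \<in> (B1_relations :: (B1_gen list \<Rightarrow>\<^sub>0 'k) set)"
      using zero by (auto simp: B1_leading_words_def B1_relations_def)
    from two_sided_ideal.mult_right[OF two_sided_ideal.base[OF this], of "mono_word u"]
    have "mono_word (x # w) \<in> ?I" unfolding zero(3) append .
    moreover have "prefix f (x # w)" using zero by simp
    ultimately show ?thesis using zero by (auto simp: left_mult_def)
  next
    case free
    then have "\<not> prefix [C1, A1, B1] (x # w)" by (auto simp: B1_leading_words_def)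
    then show ?thesis using free by (auto simp: left_mult_def two_sided_ideal.zero)
  qed
qed

lemma lin_ext_congruent:
  fixes R :: "('x list \<Rightarrow>\<^sub>0 'k::field) set"
  assumes "\<And>b. h b - h' b \<in> two_sided_ideal R"
  shows "lin_ext h u - lin_ext h' u \<in> two_sided_ideal R"
proof (induction u rule: poly_mapping_single_induct)
  case (add b c u)
  have "lin_ext h (Poly_Mapping.single b c + u) - lin_ext h' (Poly_Mapping.single b c + u)
      = scale c (h b - h' b) + (lin_ext h u - lin_ext h' u)"
    using scale_add_right[of c "h b" "- h' b"] by (simp add: lin_ext_add)
  then show ?case using add assms by (simp add: two_sided_ideal.add two_sided_ideal_scale)
qed (simp add: two_sided_ideal.zero)

lemma B1_nf_word_congruent:
  "mono_word w - B1_nf_word w \<in> two_sided_ideal (B1_relations :: (B1_gen list \<Rightarrow>\<^sub>0 'k::field) set)"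
proof (induction w)
  case (Cons x w)
  have cons: "mono_word [x] * p = lin_ext (\<lambda>w. mono_word (x # w)) p" for p :: "B1_gen list \<Rightarrow>\<^sub>0 'k"
    by (induction p rule: poly_mapping_single_induct)
      (simp_all add: lin_ext_add distrib_left mult_single plus_list_def)
  have "mono_word (x # w) - B1_nf_word (x # w) =
      mono_word [x] * (mono_word w - B1_nf_word w)
      + (lin_ext (\<lambda>w. mono_word (x # w)) (B1_nf_word w) - lin_ext (left_mult x) (B1_nf_word w) :: B1_gen list \<Rightarrow>\<^sub>0 'k)"
    unfolding cons by (simp add: lin_ext_diff B1_nf_word_Cons)
  then show ?case
    using two_sided_ideal.add[OF two_sided_ideal.mult_left[OF Cons.IH, of "mono_word [x]"]
       lin_ext_congruent[of "\<lambda>w. mono_word (x # w)" "left_mult x", OF left_mult_congruent, of "B1_nf_word w"]] by metis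
qed (simp add: two_sided_ideal.zero)

lemma B1_nf_congruent:
  "p - B1_nf p \<in> two_sided_ideal (B1_relations :: (B1_gen list \<Rightarrow>\<^sub>0 'k::field) set)"
  using lin_ext_congruent[of "\<lambda>w. mono_word w" B1_nf_word, OF B1_nf_word_congruent, of p] by (simp add: B1_nf_conv)

lemma B1_nf_zero_ideal: "p \<in> two_sided_ideal B1_relations \<Longrightarrow> B1_nf p = 0"
  by (simp add: B1_nf_def act_ideal)

lemma B1_nf_diff: "B1_nf (p - q) = B1_nf p - B1_nf q"
  by (simp add: B1_nf_conv lin_ext_diff)

section \<open>The Groebner basis of the relations\<close>

lemma B1_nf_word_le:
  assumes "v \<in> Poly_Mapping.keys (B1_nf_word w :: B1_gen list \<Rightarrow>\<^sub>0 'k::field)"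
  shows "v = w \<or> (v, w) \<in> B1_order"
  using assms
proof (induction w arbitrary: v)
  case (Cons x w)
  obtain u where u: "u \<in> Poly_Mapping.keys (B1_nf_word w :: B1_gen list \<Rightarrow>\<^sub>0 'k)"
    "v \<in> Poly_Mapping.keys (left_mult x u :: B1_gen list \<Rightarrow>\<^sub>0 'k)"
    using Cons.prems unfolding B1_nf_word_Cons by (rule keys_lin_extE)
  have "v = x # u \<or> (v, x # u) \<in> B1_order"
    using u(2) by (auto simp: left_mult_def B1_order_def prefix_def Cons_lenlex_iff split: if_splits)
  moreover have "x # u = x # w \<or> (x # u, x # w) \<in> B1_order"
    using Cons.IH[OF u(1)] by (auto simp: B1_order_def Cons_lenlex_iff)
  ultimately show ?case using B1.trans_less by (metis transD)
qed simp

text \<open>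
  Reduction never increases a word, so a normal leading word \<open>w\<close> of \<open>p\<close> is untouched by the
  reductions of the other words of \<open>p\<close>, and its coefficient survives in the normal form of \<open>p\<close>. But that
  normal form is zero.
\<close>

lemma leading_word_ideal:
  fixes p :: "B1_gen list \<Rightarrow>\<^sub>0 'k::field"
  assumes p: "p \<in> two_sided_ideal B1_relations" "p \<noteq> 0"
  shows "\<not> B1_normal (leading_word B1_order p)" (is "\<not> B1_normal ?w")
proof
  assume normal: "B1_normal ?w"
  let ?c = "Poly_Mapping.lookup p ?w"
  have other: "Poly_Mapping.lookup (B1_nf_word v :: B1_gen list \<Rightarrow>\<^sub>0 'k) ?w = 0"
    if "v \<in> Poly_Mapping.keys p - {?w}" for v
    using B1.leading_word_greatest(2)[OF p(2), of v] that B1_nf_word_le[of ?w v, where 'k = 'k] B1.less_asym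
    by (auto simp: in_keys_iff)
  have "0 = Poly_Mapping.lookup (B1_nf p) ?w" using B1_nf_zero_ideal[OF p(1)] by simp
  also have "\<dots> = (\<Sum>v\<in>Poly_Mapping.keys p. Poly_Mapping.lookup p v * Poly_Mapping.lookup (B1_nf_word v) ?w)"
    by (simp add: B1_nf_conv lin_ext_def lookup_sum)
  also have "\<dots> = ?c * Poly_Mapping.lookup (B1_nf_word ?w) ?w"
    using other by (subst sum.remove[OF _ B1.leading_word_greatest(1)[OF p(2)]]) simp_all
  also have "\<dots> = ?c" using B1_nf_word_normal[OF normal, where 'k = 'k] by simp
  finally show False using B1.leading_word_greatest(1)[OF p(2)] by (simp add: in_keys_iff)
qed

lemma leading_word_mono_word [simp]:
  "leading_word B1_order (mono_word w :: B1_gen list \<Rightarrow>\<^sub>0 'k::field) = w"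
  by (rule B1.leading_word_eqI) auto

lemma keys_binomial_relation:
  "Poly_Mapping.keys (mono_word [A0, B0, C0] + mono_word [C1, A1, B1] :: B1_gen list \<Rightarrow>\<^sub>0 'k::field) = {[A0, B0, C0], [C1, A1, B1]}"
  by (auto simp: in_keys_iff lookup_add lookup_single when_def split: if_splits)

lemma leading_word_binomial_relation [simp]:
  "leading_word B1_order (mono_word [A0, B0, C0] + mono_word [C1, A1, B1] :: B1_gen list \<Rightarrow>\<^sub>0 'k::field) = [C1, A1, B1]"
  by (rule B1.leading_word_eqI) (auto simp: keys_binomial_relation B1_order_def Cons_lenlex_iff)

lemma B1_leading_words_eq:
  "leading_word B1_order ` (B1_relations :: (B1_gen list \<Rightarrow>\<^sub>0 'k::field) set) = B1_leading_words"
  by (simp add: B1_relations_def B1_leading_words_def)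

lemma B1_relations_groebner:
  "is_reduced_groebner_basis B1_relations B1_order (B1_relations :: (B1_gen list \<Rightarrow>\<^sub>0 'k::field) set)"
  unfolding is_reduced_groebner_basis_def
proof (intro conjI ballI impI)
  show "B1_relations \<subseteq> two_sided_ideal (B1_relations :: (B1_gen list \<Rightarrow>\<^sub>0 'k) set)"
    by (auto intro: two_sided_ideal.base)
  show "0 \<notin> (B1_relations :: (B1_gen list \<Rightarrow>\<^sub>0 'k) set)"
    using keys_binomial_relation[where 'k = 'k]
    by (auto simp: B1_relations_def simp flip: keys_eq_empty)
  show "\<exists>g\<in>B1_relations :: (B1_gen list \<Rightarrow>\<^sub>0 'k) set. sublist (leading_word B1_order g) (leading_word B1_order p)"
    if "p \<in> two_sided_ideal B1_relations" "p \<noteq> 0" for p :: "B1_gen list \<Rightarrow>\<^sub>0 'k"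
    using leading_word_ideal[OF that]
    unfolding B1_normal_def B1_leading_words_eq[where 'k = 'k, symmetric] by blast
  show "Poly_Mapping.lookup g (leading_word B1_order g) = 1"
    if "g \<in> B1_relations" for g :: "B1_gen list \<Rightarrow>\<^sub>0 'k"
    using that by (auto simp: B1_relations_def lookup_add lookup_single)
  show "\<not> sublist (leading_word B1_order h) w"
    if "g \<in> B1_relations" "h \<in> B1_relations" "h \<noteq> g" "w \<in> Poly_Mapping.keys g"
    for g h :: "B1_gen list \<Rightarrow>\<^sub>0 'k" and w
    using that unfolding B1_relations_def
    by (auto simp: keys_binomial_relation sublist_Cons_right)
qed

lemma B1_obstructions [simp]:
  "obstructions (B1_relations :: (B1_gen list \<Rightarrow>\<^sub>0 'k::field) set) B1_order = B1_leading_words"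
  unfolding obstructions_def
  by (simp add: B1.reduced_groebner_basis_eqI[OF B1_relations_groebner] B1_leading_words_eq)

lemma normal_word_B1 [simp]:
  "normal_word (B1_relations :: (B1_gen list \<Rightarrow>\<^sub>0 'k::field) set) B1_order w \<longleftrightarrow> B1_normal w"
  by (simp add: normal_word_def B1_normal_def)

lemma normal_form_B1 [simp]:
  "normal_form B1_relations B1_order (p :: B1_gen list \<Rightarrow>\<^sub>0 'k::field) = B1_nf p"
  unfolding normal_form_def normal_word_B1
proof (rule the_equality)
  show "p - B1_nf p \<in> two_sided_ideal B1_relations \<and> (\<forall>w\<in>Poly_Mapping.keys (B1_nf p). B1_normal w)"
    using B1_nf_congruent B1_nf_keys_normal by blast
  fix q assume q: "p - q \<in> two_sided_ideal B1_relations \<and> (\<forall>w\<in>Poly_Mapping.keys q. B1_normal w)"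
  then have "B1_nf q = q" by (intro B1_nf_normal) auto
  with q show "q = B1_nf p" using B1_nf_zero_ideal[of "p - q"] by (simp add: B1_nf_diff)
qed

section \<open>The chains\<close>

text \<open>
  The obstructions do not depend on the field. Stating occurrences and chains in terms of the explicit
  list keeps the combinatorics free of the coefficient type.
\<close>

definition B1_occurrences where
  "B1_occurrences w = {(p, f, q). f \<in> B1_leading_words \<and> w = p @ f @ q}"

lemma occurrences_B1 [simp]:
  "occurrences (B1_relations :: (B1_gen list \<Rightarrow>\<^sub>0 'k::field) set) B1_order w = B1_occurrences w"
  by (simp add: occurrences_def B1_occurrences_def)

text \<open>
  \<open>next_tail r t\<close>: a chain with tail \<open>r\<close> can be extended by the tail \<open>t\<close>. A tail \<open>a\<^sub>0\<close> or \<open>b\<^sub>0\<close> has no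
  successor because no leading word begins with these letters.
\<close>

inductive next_tail :: "B1_gen list \<Rightarrow> B1_gen list \<Rightarrow> bool" where
  "next_tail [A1] [B1, C1]"
| "next_tail [B1, C1] [A1]"
| "next_tail [B1] [C1, A1]"
| "next_tail [C1, A1] [B1]"
| "next_tail [C1] [A1, B1]"
| "next_tail [A1, B1] [C1]"
| "next_tail [A1, B1] [A0]"
| "next_tail [B1] [A0]"
| "next_tail [C0] [C1]"
| "next_tail [C0] [A0]"

lemma B1_occurrences_Nil: "B1_occurrences [] = {}"
  by (auto simp: B1_occurrences_def B1_leading_words_def)

lemma B1_occurrences_Cons:
  "B1_occurrences (x # w) =
    (\<Union>f\<in>B1_leading_words. if prefix f (x # w) then {([], f, drop (length f) (x # w))} else {})
      \<union> (\<lambda>(p, f, q). (x # p, f, q)) ` B1_occurrences w"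
  by (auto simp: B1_occurrences_def Cons_eq_append_conv image_iff prefix_def)

lemma next_tail_sound:
  assumes "next_tail r t"
  shows "B1_normal t" and "\<exists>p f. B1_occurrences (r @ t) = {(p, f, [])}"
proof -
  show "B1_normal t"
    using assms by cases (simp_all add: B1_normal_Cons B1_leading_words_def)
  show "\<exists>p f. B1_occurrences (r @ t) = {(p, f, [])}"
    using assms by cases (simp_all add: B1_leading_words_def B1_occurrences_Cons B1_occurrences_Nil)
qed

text \<open>
  Since \<open>t\<close> is normal, the final occurrence of \<open>f\<close> in \<open>rt\<close> starts inside \<open>r\<close>. If \<open>r\<close> has two
  letters and \<open>f\<close> starts at the second one, then \<open>f\<close> of length three would produce another occurrence at
  the beginning of \<open>rt\<close>, because the words \<open>a\<^sub>1b\<^sub>1c\<^sub>1\<close>, \<open>b\<^sub>1c\<^sub>1a\<^sub>1\<close> and \<open>c\<^sub>1a\<^sub>1b\<^sub>1\<close> are the cyclic rotations of each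
  other; only \<open>f = b\<^sub>1a\<^sub>0\<close> remains.
\<close>

lemma next_tail_complete:
  assumes "(\<exists>x. r = [x]) \<or> r \<in> {[B1, C1], [C1, A1], [A1, B1]}"
    and t: "B1_normal t" and occ: "B1_occurrences (r @ t) = {(p, f, [])}"
  shows "next_tail r t"
proof -
  have "(p, f, []) \<in> B1_occurrences (r @ t)"
    using occ by simp
  then have f: "f \<in> B1_leading_words" and eq: "r @ t = p @ f"
    by (simp_all add: B1_occurrences_def)
  have "\<not> suffix f t"
    using t f suffix_imp_sublist by (auto simp: B1_normal_def)
  then have short: "length p < length r"
    using eq[unfolded append_eq_append_conv2] by (force simp: suffix_def)
  have uniq: "q = []" if "r @ t = p' @ f' @ q" "f' \<in> B1_leading_words" for p' f' q
  proof -
    have "(p', f', q) \<in> B1_occurrences (r @ t)" using that by (simp add: B1_occurrences_def)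
    then show ?thesis using occ by simp
  qed
  have pre: "q = []" if "r @ t = f' @ q" "f' \<in> B1_leading_words" for f' q
    using uniq[of "[]"] that by simp
  consider x where "r = [x]" | y z where "r = [y, z]" "p = [] \<or> p = [y]"
  proof -
    have "p = [] \<or> p = [y]" if "r = [y, z]" for y z
      using short eq that by (cases p) auto
    then show thesis using that assms(1) by blast
  qed
  then show ?thesis
  proof cases
    case 1
    then have "x # t = f" using short eq by simp
    then show ?thesis using f 1
      by (auto simp: B1_leading_words_def intro: next_tail.intros)
  next
    case 2
    then have r: "r \<in> {[B1, C1], [C1, A1], [A1, B1]}" using assms(1) by auto
    from 2(2) show ?thesis
    proof
      assume "p = []"
      then have "r @ t = f" using eq by simp
      then show ?thesis using f r
        by (auto simp: B1_leading_words_def intro: next_tail.intros)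
    next
      assume "p = [y]"
      then have zt: "z # t = f" using eq 2(1) by simp
      then have "y = A1 \<and> z = B1 \<and> t = [A0]"
        using f r 2(1) pre[of "[A1, B1, C1]" "[A1]"] pre[of "[B1, C1, A1]" "[B1]"] pre[of "[C1, A1, B1]" "[C1]"]
        by (auto simp: B1_leading_words_def)
      then show ?thesis using 2(1) by (simp add: next_tail.intros)
    qed
  qed
qed

inductive B1_chain :: "nat \<Rightarrow> B1_gen list \<Rightarrow> B1_gen list \<Rightarrow> bool" where
  generator: "B1_chain 0 [x] [x]"
| extend: "B1_chain n g r \<Longrightarrow> next_tail r t \<Longrightarrow> B1_chain (Suc n) (g @ t) t"

lemma B1_chain_tail:
  assumes "B1_chain n w t"
  shows "(\<exists>x. t = [x]) \<or> t \<in> {[B1, C1], [C1, A1], [A1, B1]}"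
  using assms
proof cases
  case (extend m g r)
  from \<open>next_tail r t\<close> show ?thesis by cases simp_all
qed simp

lemma tail_chain_B1 [simp]:
  "tail_chain (B1_relations :: (B1_gen list \<Rightarrow>\<^sub>0 'k::field) set) B1_order n w t \<longleftrightarrow> B1_chain n w t"
proof
  assume "tail_chain (B1_relations :: (B1_gen list \<Rightarrow>\<^sub>0 'k) set) B1_order n w t"
  then show "B1_chain n w t"
  proof induction
    case (extend n g r t p f)
    then show ?case
      using next_tail_complete[OF B1_chain_tail[OF extend.IH]]
      by (simp add: B1_chain.extend)
  qed (rule B1_chain.generator)
next
  assume "B1_chain n w t"
  then show "tail_chain (B1_relations :: (B1_gen list \<Rightarrow>\<^sub>0 'k) set) B1_order n w t"
  proof induction
    case (extend n g r t)
    obtain p f where "B1_occurrences (r @ t) = {(p, f, [])}"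
      using next_tail_sound(2)[OF extend.hyps(2)] by blast
    then show ?case
      using tail_chain.extend[OF extend.IH, of t p f] next_tail_sound(1)[OF extend.hyps(2)] by simp
  qed (rule tail_chain.generator)
qed

lemma anick_chain_B1 [simp]:
  "anick_chain (B1_relations :: (B1_gen list \<Rightarrow>\<^sub>0 'k::field) set) B1_order n w \<longleftrightarrow> (\<exists>t. B1_chain n w t)"
  by (simp add: anick_chain_def)

abbreviation "abc \<equiv> [A1, B1, C1]"
abbreviation "cab \<equiv> [C1, A1, B1]"
abbreviation "bca \<equiv> [B1, C1, A1]"

lemma word_power_0 [simp]: "w \<^bold>^ 0 = []"
  by (simp add: word_power_def)

lemma word_power_Suc: "w \<^bold>^ Suc m = w \<^bold>^ m @ w"
  by (induction m) (simp_all add: word_power_def)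

text \<open>
  In degree zero the tail of \<open>c\<^sub>0\<close> is the letter itself instead of \<open>a\<^sub>1b\<^sub>1\<close>, and there is the
  additional chain \<open>b\<^sub>0\<close>, which extends to no chain of degree one.
\<close>

definition even_chains :: "nat \<Rightarrow> (B1_gen list \<times> B1_gen list) set" where
  "even_chains m =
    {(abc \<^bold>^ m @ [A1], [A1]), (cab \<^bold>^ m @ [C1], [C1]), (cab \<^bold>^ m @ [A0], [A0]),
     (bca \<^bold>^ m @ [B1], [B1]), ([C0] @ cab \<^bold>^ m, if m = 0 then [C0] else [A1, B1])} \<union>
    (if m = 0 then {([B0], [B0])} else {})"

definition odd_chains :: "nat \<Rightarrow> (B1_gen list \<times> B1_gen list) set" where
  "odd_chains m =
    {(abc \<^bold>^ (m + 1), [B1, C1]), (cab \<^bold>^ (m + 1), [A1, B1]), (bca \<^bold>^ (m + 1), [C1, A1]),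
     (bca \<^bold>^ m @ [B1, A0], [A0]), ([C0] @ cab \<^bold>^ m @ [C1], [C1]), ([C0] @ cab \<^bold>^ m @ [A0], [A0])}"


lemma next_tail_set:
  "{t. next_tail [A1] t} = {[B1, C1]}" "{t. next_tail [B1] t} = {[C1, A1], [A0]}"
  "{t. next_tail [C1] t} = {[A1, B1]}" "{t. next_tail [C0] t} = {[C1], [A0]}"
  "{t. next_tail [A0] t} = {}" "{t. next_tail [B0] t} = {}"
  "{t. next_tail [B1, C1] t} = {[A1]}" "{t. next_tail [C1, A1] t} = {[B1]}"
  "{t. next_tail [A1, B1] t} = {[C1], [A0]}"
  by (auto simp: next_tail.simps)

lemma B1_chain_0: "B1_chain 0 w t \<longleftrightarrow> (w, t) \<in> even_chains 0"
proof -
  have "(\<exists>x. w = [x] \<and> t = [x]) \<longleftrightarrow> (w, t) \<in> (\<lambda>x. ([x], [x])) ` UNIV"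
    by blast
  also have "UNIV = {A0, B0, C0, A1, B1, C1}"
    by (auto intro: B1_gen.exhaust)
  finally show ?thesis
    by (auto simp: B1_chain.simps[of 0] even_chains_def)
qed

lemma B1_chain_Suc_set:
  "{(w, t). B1_chain (Suc n) w t} =
    (\<Union>(g, r)\<in>{(g, r). B1_chain n g r}. (\<lambda>t. (g @ t, t)) ` {t. next_tail r t})"
  by (auto simp: B1_chain.simps[of "Suc n"])

lemma extend_even_chains:
  "(\<Union>(g, r)\<in>even_chains m. (\<lambda>t. (g @ t, t)) ` {t. next_tail r t}) = odd_chains m"
  by (auto simp: even_chains_def odd_chains_def next_tail_set word_power_Suc)

lemma extend_odd_chains:
  "(\<Union>(g, r)\<in>odd_chains m. (\<lambda>t. (g @ t, t)) ` {t. next_tail r t}) = even_chains (Suc m)"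
  by (auto simp: even_chains_def odd_chains_def next_tail_set word_power_Suc)

lemma B1_chains_set:
  "{(w, t). B1_chain (2 * m) w t} = even_chains m"
  "{(w, t). B1_chain (2 * m + 1) w t} = odd_chains m"
proof -
  have "{(w, t). B1_chain (2 * m) w t} = even_chains m \<and> {(w, t). B1_chain (2 * m + 1) w t} = odd_chains m"
  proof (induction m)
    case 0
    have "{(w, t). B1_chain 0 w t} = even_chains 0" by (auto simp: B1_chain_0)
    then show ?case by (simp add: B1_chain_Suc_set extend_even_chains)
  next
    case (Suc m)
    then show ?case by (simp add: B1_chain_Suc_set extend_odd_chains extend_even_chains)
  qed
  then show "{(w, t). B1_chain (2 * m) w t} = even_chains m"
  "{(w, t). B1_chain (2 * m + 1) w t} = odd_chains m" by blast+
qed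

lemma B1_chain_even: "B1_chain (2 * m) w t \<longleftrightarrow> (w, t) \<in> even_chains m"
  using B1_chains_set(1)[of m] by blast

lemma B1_chain_odd: "B1_chain (Suc (2 * m)) w t \<longleftrightarrow> (w, t) \<in> odd_chains m"
  using B1_chains_set(2)[of m] by auto

text \<open>
  The only tails with two successors are \<open>b\<^sub>1\<close>, \<open>a\<^sub>1b\<^sub>1\<close> and \<open>c\<^sub>0\<close>, and the two successors differ in
  their first letter.
\<close>

lemma next_tail_prefix_unique:
  "next_tail r t \<Longrightarrow> next_tail r t' \<Longrightarrow> t @ c = t' @ c' \<Longrightarrow> t = t'"
  by (auto simp: next_tail.simps)

text \<open>
  Read from the left, a word admits at each stage at most one tail that can be split off.
\<close>

lemma chain_prefix_unique:
  assumes "B1_chain n g t" "B1_chain n g' t'" "g @ c = g' @ c'"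
  shows "g = g' \<and> t = t'"
  using assms
proof (induction arbitrary: g' t' c c' rule: B1_chain.induct)
  case (generator x)
  then show ?case by (auto simp: B1_chain.simps[of 0])
next
  case (extend n g r t)
  from extend.prems(1) obtain h r'
    where h: "B1_chain n h r'" "next_tail r' t'" "g' = h @ t'"
    by (auto simp: B1_chain.simps[of "Suc n"])
  have eq: "g @ (t @ c) = h @ (t' @ c')" using extend.prems(2) h(3) by simp
  then have "g = h" "r = r'" using extend.IH[OF h(1)] by blast+
  moreover have "t = t'"
    using next_tail_prefix_unique extend.hyps(2) h(2) eq calculation by (metis same_append_eq)
  ultimately show ?case using h(3) by simp
qed

section \<open>One step of the resolution\<close>

abbreviation B1_differential :: "nat \<Rightarrow> (B1_gen, 'k::field) chain_module \<Rightarrow> (B1_gen, 'k) chain_module" where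
  "B1_differential \<equiv> anick_differential B1_relations B1_order"

abbreviation B1_action :: "(B1_gen, 'k::field) chain_module \<Rightarrow> B1_gen list \<Rightarrow> (B1_gen, 'k) chain_module" where
  "B1_action u s \<equiv> right_action B1_relations B1_order u (mono_word s)"

text \<open>
  The element \<open>f \<otimes> w\<close> of the module, where \<open>w\<close> stands for its class in the algebra and need not be a
  normal word.
\<close>

definition reduced_tensor :: "B1_gen list \<Rightarrow> B1_gen list \<Rightarrow> (B1_gen, 'k::field) chain_module" where
  "reduced_tensor f w = tensor_elem f (B1_nf_word w)"

lemma reduced_tensor_normal: "B1_normal w \<Longrightarrow> reduced_tensor f w = f \<otimes>\<^sub>K w"
  by (simp add: reduced_tensor_def B1_nf_word_normal tensor_elem_def)

lemma B1_action_term [simp]: "B1_action (f \<otimes>\<^sub>K s) t = reduced_tensor f (s @ t)"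
  by (simp add: right_action_def term_tensor_def reduced_tensor_def mult_single plus_list_def B1_nf_conv)

lemma B1_action_add: "B1_action (u + v) s = B1_action u s + B1_action v s"
  by (simp add: right_action_def lin_ext_add)

lemma B1_differential_0:
  "B1_differential 0 ([x] \<otimes>\<^sub>K s) = (reduced_tensor [] (x # s) :: (B1_gen, 'k::field) chain_module)"
proof -
  have "B1_normal [x]" by (simp add: B1_normal_Cons B1_leading_words_def)
  then have "tensor_elem [] (B1_nf (mono_word [x])) = ([] \<otimes>\<^sub>K [x] :: (B1_gen, 'k) chain_module)"
    using reduced_tensor_normal[of "[x]" "[]"] by (simp add: reduced_tensor_def B1_nf_conv)
  then show ?thesis
    by (simp add: module_ext_def term_tensor_def[of "[x]"])
qed

text \<open>
  The definition recovers the factorization \<open>w = gt\<close> from \<open>w\<close> by a definite description;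
  \<open>chain_prefix_unique\<close> shows that it is determined.
\<close>

lemma B1_differential_Suc:
  assumes "B1_chain n g r" "next_tail r t"
  shows "B1_differential (Suc n) ((g @ t) \<otimes>\<^sub>K s) =
    B1_action (g \<otimes>\<^sub>K t - splitting B1_relations B1_order n (B1_differential n) (B1_differential n (g \<otimes>\<^sub>K t))) s"
proof -
  have chain: "B1_chain (Suc n) (g @ t) t" using assms by (rule B1_chain.extend)
  have "(THE (g', t'). g @ t = g' @ t' \<and> (\<exists>r. B1_chain n g' r) \<and> B1_chain (Suc n) (g @ t) t') = (g, t)"
  proof (rule the_equality)
    show "case (g, t) of (g', t') \<Rightarrow> g @ t = g' @ t' \<and> (\<exists>r. B1_chain n g' r) \<and> B1_chain (Suc n) (g @ t) t'"
      using assms chain by auto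
    fix p assume p: "case p of (g', t') \<Rightarrow> g @ t = g' @ t' \<and> (\<exists>r. B1_chain n g' r) \<and> B1_chain (Suc n) (g @ t) t'"
    obtain g' t' where p_eq: "p = (g', t')" by fastforce
    have "B1_chain (Suc n) (g @ t) t'" using p unfolding p_eq prod.case by blast
    from chain_prefix_unique[OF chain this refl] have "t' = t" by simp
    then show "p = (g, t)" using p p_eq by simp
  qed
  then show ?thesis
    by (simp add: module_ext_def term_tensor_def[of "g @ t"])
qed

text \<open>
  From here on the differential is used only through \<open>B1_differential_0\<close> and \<open>B1_differential_Suc\<close>.
\<close>

declare anick_differential.simps [simp del]

lemma splitting_zero [simp]: "splitting R less_word n D 0 = 0"
proof -
  have "splitting_rel R less_word n D 0 v \<longleftrightarrow> v = 0" for v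
    by (auto simp: is_leading_term_def intro: splitting_rel.zero elim: splitting_rel.cases)
  then show ?thesis by (simp add: splitting_def)
qed

text \<open>
  One step of the recursion suffices: the only term of \<open>-f \<otimes> xs\<close> is cancelled by the boundary of
  \<open>fx \<otimes> s\<close>, and \<open>fx\<close> is the only \<open>n\<close>-chain that is a prefix of \<open>fxs\<close>. The hypothesis \<open>B1_chain n (f @ [x]) t\<close>
  forces \<open>f\<close> to be empty in degree zero, so that the direct definition of the splitting there gives
  the same answer.
\<close>

lemma splitting_minus_term:
  fixes D :: "(B1_gen, 'k::field) chain_module \<Rightarrow> (B1_gen, 'k) chain_module"
  assumes chain: "B1_chain n (f @ [x]) t" and normal: "B1_normal s"
    and D: "D ((f @ [x]) \<otimes>\<^sub>K s) = f \<otimes>\<^sub>K (x # s)"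
  shows "splitting B1_relations B1_order n D (- (f \<otimes>\<^sub>K (x # s))) = - ((f @ [x]) \<otimes>\<^sub>K s)"
proof (cases "n = 0")
  case True
  then have "f = []" using chain by (simp add: B1_chain.simps[of 0])
  then show ?thesis using True by (simp add: splitting_def term_tensor_def)
next
  case False
  let ?u = "- (f \<otimes>\<^sub>K (x # s)) :: (B1_gen, 'k) chain_module"
  have keys: "Poly_Mapping.keys ?u = {(f, x # s)}" by (simp add: term_tensor_def)
  have coeff: "Poly_Mapping.lookup ?u (f, x # s) = - 1" by (simp add: term_tensor_def)
  have lead: "is_leading_term B1_order ?u f' s' \<longleftrightarrow> f' = f \<and> s' = x # s" for f' s'
    unfolding is_leading_term_def keys by auto
  have rest: "?u - scale (- 1) (D ((f @ [x]) \<otimes>\<^sub>K s)) = 0" by (simp add: D)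
  have zero: "v = 0" if "splitting_rel B1_relations B1_order n D 0 v" for v
    using that by cases (auto simp: is_leading_term_def)
  have "splitting_rel B1_relations B1_order n D ?u v \<longleftrightarrow> v = - ((f @ [x]) \<otimes>\<^sub>K s)" for v
  proof
    assume "splitting_rel B1_relations B1_order n D ?u v"
    then show "v = - ((f @ [x]) \<otimes>\<^sub>K s)"
    proof cases
      case zero
      then show ?thesis using keys by simp
    next
      case (step f' s' \<alpha> g c v')
      then have fs: "f' = f" "s' = x # s" using lead by blast+
      have "g = f @ [x]"
        using step fs chain chain_prefix_unique[of n "f @ [x]" t g _ s c] by auto
      moreover have "c = s" using step fs calculation by simp
      moreover have "\<alpha> = - 1" using step fs coeff by simp
      ultimately have "splitting_rel B1_relations B1_order n D 0 v'" using step rest by metis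
      then show ?thesis using zero step \<open>g = f @ [x]\<close> \<open>c = s\<close> \<open>\<alpha> = - 1\<close> by simp
    qed
  next
    assume v: "v = - ((f @ [x]) \<otimes>\<^sub>K s)"
    have "splitting_rel B1_relations B1_order n D ?u (scale (- 1) ((f @ [x]) \<otimes>\<^sub>K s) + 0)"
    proof (rule splitting_rel.step)
      show "is_leading_term B1_order ?u f (x # s)" by (simp add: lead)
      show "splitting_rel B1_relations B1_order n D (?u - scale (- 1) (D ((f @ [x]) \<otimes>\<^sub>K s))) 0"
        unfolding rest by (rule splitting_rel.zero)
    qed (use chain normal coeff in auto)
    then show "splitting_rel B1_relations B1_order n D ?u v" using v by simp
  qed
  then have "splitting_rel B1_relations B1_order n D ?u = (\<lambda>v. v = - ((f @ [x]) \<otimes>\<^sub>K s))"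
    by blast
  then show ?thesis using False by (simp add: splitting_def)
qed

lemma B1_differential_extend:
  assumes "B1_chain n g r" "next_tail r t" "B1_differential n (g \<otimes>\<^sub>K t) = (0 :: (B1_gen, 'k::field) chain_module)"
  shows "B1_differential (Suc n) ((g @ t) \<otimes>\<^sub>K s) = (reduced_tensor g (t @ s) :: (B1_gen, 'k) chain_module)"
  using assms(3) by (simp add: B1_differential_Suc[OF assms(1,2)])

text \<open>
  The term \<open>-f \<otimes> a\<^sub>0b\<^sub>0c\<^sub>0\<close> arises by rewriting \<open>f \<otimes> c\<^sub>1a\<^sub>1b\<^sub>1\<close>; the chain \<open>fa\<^sub>0\<close> is the one that
  bounds it.
\<close>

lemma B1_differential_extend_correction:
  assumes "B1_chain n g r" "next_tail r t"
    and "B1_differential n (g \<otimes>\<^sub>K t) = - (f \<otimes>\<^sub>K [A0, B0, C0] :: (B1_gen, 'k::field) chain_module)"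
    and "B1_chain n (f @ [A0]) r'"
    and "B1_differential n ((f @ [A0]) \<otimes>\<^sub>K [B0, C0]) = (f \<otimes>\<^sub>K [A0, B0, C0] :: (B1_gen, 'k) chain_module)"
  shows "B1_differential (Suc n) ((g @ t) \<otimes>\<^sub>K s) =
    (reduced_tensor g (t @ s) + reduced_tensor (f @ [A0]) ([B0, C0] @ s) :: (B1_gen, 'k) chain_module)"
proof -
  have "B1_normal [B0, C0]" by (simp add: B1_normal_Cons B1_leading_words_def)
  from splitting_minus_term[OF assms(4) this, of "B1_differential n", OF assms(5)] assms(3)
  show ?thesis by (simp add: B1_differential_Suc[OF assms(1,2)] B1_action_add)
qed

lemma reduced_tensor_normal_words:
  "reduced_tensor f [A1] = f \<otimes>\<^sub>K [A1]" "reduced_tensor f [B1] = f \<otimes>\<^sub>K [B1]"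
  "reduced_tensor f [C1] = f \<otimes>\<^sub>K [C1]" "reduced_tensor f [A0] = f \<otimes>\<^sub>K [A0]"
  "reduced_tensor f [B1, C1] = f \<otimes>\<^sub>K [B1, C1]" "reduced_tensor f [C1, A1] = f \<otimes>\<^sub>K [C1, A1]"
  "reduced_tensor f [A1, B1] = f \<otimes>\<^sub>K [A1, B1]" "reduced_tensor f [B0, C0] = f \<otimes>\<^sub>K [B0, C0]"
  "reduced_tensor f [A0, B0, C0] = f \<otimes>\<^sub>K [A0, B0, C0]"
  by (simp_all add: reduced_tensor_normal B1_normal_Cons B1_leading_words_def)

lemma reduced_tensor_reducible_words:
  "reduced_tensor f [A1, B1, C1] = 0" "reduced_tensor f [B1, C1, A1] = 0"
  "reduced_tensor f [C1, A1, B1] = - (f \<otimes>\<^sub>K [A0, B0, C0])"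
  "reduced_tensor f [B1, A0] = 0" "reduced_tensor f [C0, C1] = 0" "reduced_tensor f [C0, A0] = 0"
  "reduced_tensor f [A1, B1, A0] = 0"
  "reduced_tensor f [B0, C0, A0] = 0" "reduced_tensor f [B0, C0, C1] = 0"
  "reduced_tensor f [B0, C0, C1, A1] = 0"
  by (simp_all add: reduced_tensor_def B1_nf_word_Cons left_mult_simps tensor_elem_def)

lemma B1_chain_odd_members:
  "B1_chain (Suc (2 * m)) (abc \<^bold>^ Suc m) [B1, C1]" "B1_chain (Suc (2 * m)) (cab \<^bold>^ Suc m) [A1, B1]"
  "B1_chain (Suc (2 * m)) (bca \<^bold>^ Suc m) [C1, A1]" "B1_chain (Suc (2 * m)) (bca \<^bold>^ m @ [B1, A0]) [A0]"
  "B1_chain (Suc (2 * m)) ([C0] @ cab \<^bold>^ m @ [C1]) [C1]" "B1_chain (Suc (2 * m)) ([C0] @ cab \<^bold>^ m @ [A0]) [A0]"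
  unfolding B1_chain_odd by (simp_all add: odd_chains_def)

lemma B1_chain_even_members:
  "B1_chain (2 * m) (abc \<^bold>^ m @ [A1]) [A1]" "B1_chain (2 * m) (cab \<^bold>^ m @ [C1]) [C1]"
  "B1_chain (2 * m) (cab \<^bold>^ m @ [A0]) [A0]" "B1_chain (2 * m) (bca \<^bold>^ m @ [B1]) [B1]"
  "B1_chain (2 * m) ([C0] @ cab \<^bold>^ m) (if m = 0 then [C0] else [A1, B1])"
  unfolding B1_chain_even by (simp_all add: even_chains_def)

section \<open>The differentials in all degrees\<close>

text \<open>
  The formulas are stated on \<open>f \<otimes> s\<close> for all words \<open>s\<close>, since the next differential is computed from
  values on \<open>g \<otimes> t\<close> and not only on free generators. The argument of type \<open>'k itself\<close> names the field,
  which the proposition otherwise would not mention.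
\<close>

definition odd_formulas :: "'k::field itself \<Rightarrow> nat \<Rightarrow> bool" where
  "odd_formulas _ m \<longleftrightarrow> (let d = B1_differential (Suc (2 * m)) :: (B1_gen, 'k) chain_module \<Rightarrow> _ in \<forall>s.
     d (abc \<^bold>^ Suc m \<otimes>\<^sub>K s) = reduced_tensor (abc \<^bold>^ m @ [A1]) ([B1, C1] @ s) \<and>
     d (cab \<^bold>^ Suc m \<otimes>\<^sub>K s) = reduced_tensor (cab \<^bold>^ m @ [C1]) ([A1, B1] @ s)
       + reduced_tensor (cab \<^bold>^ m @ [A0]) ([B0, C0] @ s) \<and>
     d (bca \<^bold>^ Suc m \<otimes>\<^sub>K s) = reduced_tensor (bca \<^bold>^ m @ [B1]) ([C1, A1] @ s) \<and>
     d ((bca \<^bold>^ m @ [B1, A0]) \<otimes>\<^sub>K s) = reduced_tensor (bca \<^bold>^ m @ [B1]) ([A0] @ s) \<and>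
     d (([C0] @ cab \<^bold>^ m @ [C1]) \<otimes>\<^sub>K s) = reduced_tensor ([C0] @ cab \<^bold>^ m) ([C1] @ s) \<and>
     d (([C0] @ cab \<^bold>^ m @ [A0]) \<otimes>\<^sub>K s) = reduced_tensor ([C0] @ cab \<^bold>^ m) ([A0] @ s))"

definition even_formulas :: "'k::field itself \<Rightarrow> nat \<Rightarrow> bool" where
  "even_formulas _ m \<longleftrightarrow> (let d = B1_differential (2 * Suc m) :: (B1_gen, 'k) chain_module \<Rightarrow> _ in \<forall>s.
     d ((abc \<^bold>^ Suc m @ [A1]) \<otimes>\<^sub>K s) = reduced_tensor (abc \<^bold>^ Suc m) ([A1] @ s) \<and>
     d ((cab \<^bold>^ Suc m @ [C1]) \<otimes>\<^sub>K s) = reduced_tensor (cab \<^bold>^ Suc m) ([C1] @ s) \<and>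
     d ((cab \<^bold>^ Suc m @ [A0]) \<otimes>\<^sub>K s) = reduced_tensor (cab \<^bold>^ Suc m) ([A0] @ s) \<and>
     d ((bca \<^bold>^ Suc m @ [B1]) \<otimes>\<^sub>K s) = reduced_tensor (bca \<^bold>^ Suc m) ([B1] @ s)
       + reduced_tensor (bca \<^bold>^ m @ [B1, A0]) ([B0, C0] @ s) \<and>
     d (([C0] @ cab \<^bold>^ Suc m) \<otimes>\<^sub>K s) = reduced_tensor ([C0] @ cab \<^bold>^ m @ [C1]) ([A1, B1] @ s)
       + reduced_tensor ([C0] @ cab \<^bold>^ m @ [A0]) ([B0, C0] @ s))"

text \<open>
  The part of the even formulas that the step to odd degree needs, in a form that also holds in degree
  zero. There \<open>b\<^sub>1 \<otimes> 1\<close> and \<open>c\<^sub>0 \<otimes> 1\<close> are mapped to \<open>1 \<otimes> b\<^sub>1\<close> and \<open>1 \<otimes> c\<^sub>0\<close>, which do not have the shape of the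
  formulas in positive even degree; but their products with the possible next tails vanish in all even
  degrees.
\<close>

definition even_invariant :: "'k::field itself \<Rightarrow> nat \<Rightarrow> bool" where
  "even_invariant _ m \<longleftrightarrow> (let d = B1_differential (2 * m) :: (B1_gen, 'k) chain_module \<Rightarrow> _ in
     (\<forall>s. d ((abc \<^bold>^ m @ [A1]) \<otimes>\<^sub>K s) = reduced_tensor (abc \<^bold>^ m) ([A1] @ s) \<and>
       d ((cab \<^bold>^ m @ [C1]) \<otimes>\<^sub>K s) = reduced_tensor (cab \<^bold>^ m) ([C1] @ s) \<and>
       d ((cab \<^bold>^ m @ [A0]) \<otimes>\<^sub>K s) = reduced_tensor (cab \<^bold>^ m) ([A0] @ s)) \<and>
     d ((bca \<^bold>^ m @ [B1]) \<otimes>\<^sub>K [C1, A1]) = 0 \<and> d ((bca \<^bold>^ m @ [B1]) \<otimes>\<^sub>K [A0]) = 0 \<and>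
     d (([C0] @ cab \<^bold>^ m) \<otimes>\<^sub>K [C1]) = 0 \<and> d (([C0] @ cab \<^bold>^ m) \<otimes>\<^sub>K [A0]) = 0)"

lemma even_invariant_0: "even_invariant TYPE('k::field) 0"
  by (simp add: even_invariant_def B1_differential_0 reduced_tensor_reducible_words)

lemma even_invariant_Suc: "even_formulas TYPE('k::field) m \<Longrightarrow> even_invariant TYPE('k) (Suc m)"
  by (simp add: even_invariant_def even_formulas_def reduced_tensor_reducible_words Let_def)

text \<open>
  Among the elements \<open>g \<otimes> t\<close> whose word \<open>gt\<close> is a chain of degree \<open>2m + 1\<close>, only
  \<open>(c\<^sub>1a\<^sub>1b\<^sub>1)\<^sup>mc\<^sub>1 \<otimes> a\<^sub>1b\<^sub>1\<close> has a nonzero boundary, the rewriting of \<open>(c\<^sub>1a\<^sub>1b\<^sub>1)\<^sup>m \<otimes> c\<^sub>1a\<^sub>1b\<^sub>1\<close>.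
\<close>

lemma odd_from_even:
  assumes "even_invariant TYPE('k::field) m"
  shows "odd_formulas TYPE('k) m"
proof -
  let ?d = "B1_differential (Suc (2 * m)) :: (B1_gen, 'k) chain_module \<Rightarrow> _"
  note tensors = reduced_tensor_normal_words reduced_tensor_reducible_words
  note inv = assms[unfolded even_invariant_def Let_def]
  have "?d (((abc \<^bold>^ m @ [A1]) @ [B1, C1]) \<otimes>\<^sub>K s) = reduced_tensor (abc \<^bold>^ m @ [A1]) ([B1, C1] @ s)" for s
    by (rule B1_differential_extend[OF B1_chain_even_members(1)])
      (simp_all add: inv tensors next_tail.intros)
  moreover have "?d (((cab \<^bold>^ m @ [C1]) @ [A1, B1]) \<otimes>\<^sub>K s) =
      reduced_tensor (cab \<^bold>^ m @ [C1]) ([A1, B1] @ s) + reduced_tensor (cab \<^bold>^ m @ [A0]) ([B0, C0] @ s)" for s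
    by (rule B1_differential_extend_correction[OF B1_chain_even_members(2) _ _ B1_chain_even_members(3)])
      (simp_all add: inv tensors next_tail.intros)
  moreover have "?d (((bca \<^bold>^ m @ [B1]) @ t) \<otimes>\<^sub>K s) = reduced_tensor (bca \<^bold>^ m @ [B1]) (t @ s)"
    if "t = [C1, A1] \<or> t = [A0]" for s t
    by (rule B1_differential_extend[OF B1_chain_even_members(4)])
      (use that in \<open>auto simp: inv next_tail.intros\<close>)
  moreover have "?d ((([C0] @ cab \<^bold>^ m) @ t) \<otimes>\<^sub>K s) = reduced_tensor ([C0] @ cab \<^bold>^ m) (t @ s)"
    if "t = [C1] \<or> t = [A0]" for s t
    by (rule B1_differential_extend[OF B1_chain_even_members(5)])
      (use that in \<open>auto simp: next_tail.intros inv[simplified]\<close>)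
  ultimately show ?thesis
    by (simp add: odd_formulas_def Let_def word_power_Suc)
qed

text \<open>
  Among the elements \<open>g \<otimes> t\<close> whose word \<open>gt\<close> is a chain of degree \<open>2m + 2\<close>, those with
  nonzero boundary are \<open>(b\<^sub>1c\<^sub>1a\<^sub>1)\<^sup>m\<^sup>+\<^sup>1 \<otimes> b\<^sub>1\<close> and
  \<open>c\<^sub>0(c\<^sub>1a\<^sub>1b\<^sub>1)\<^sup>mc\<^sub>1 \<otimes> a\<^sub>1b\<^sub>1\<close>; there multiplication by \<open>t\<close> completes a factor \<open>c\<^sub>1a\<^sub>1b\<^sub>1\<close>.
\<close>

lemma even_from_odd:
  assumes "odd_formulas TYPE('k::field) m"
  shows "even_formulas TYPE('k) m"
proof -
  let ?d = "B1_differential (Suc (Suc (2 * m))) :: (B1_gen, 'k) chain_module \<Rightarrow> _"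
  note tensors = reduced_tensor_normal_words reduced_tensor_reducible_words
  note inv = assms[unfolded odd_formulas_def Let_def, rule_format]
  have "?d ((abc \<^bold>^ Suc m @ [A1]) \<otimes>\<^sub>K s) = reduced_tensor (abc \<^bold>^ Suc m) ([A1] @ s)" for s
    by (rule B1_differential_extend[OF B1_chain_odd_members(1)])
      (simp_all add: inv tensors next_tail.intros)
  moreover have "?d ((cab \<^bold>^ Suc m @ t) \<otimes>\<^sub>K s) = reduced_tensor (cab \<^bold>^ Suc m) (t @ s)"
    if "t = [C1] \<or> t = [A0]" for s t
    by (rule B1_differential_extend[OF B1_chain_odd_members(2)])
      (use that in \<open>auto simp: inv tensors next_tail.intros\<close>)
  moreover have "?d ((bca \<^bold>^ Suc m @ [B1]) \<otimes>\<^sub>K s) =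
      reduced_tensor (bca \<^bold>^ Suc m) ([B1] @ s) + reduced_tensor ((bca \<^bold>^ m @ [B1]) @ [A0]) ([B0, C0] @ s)" for s
    by (rule B1_differential_extend_correction[OF B1_chain_odd_members(3)])
      (use inv B1_chain_odd_members(4)[of m] in \<open>simp_all add: tensors next_tail.intros\<close>)
  moreover have "?d ((([C0] @ cab \<^bold>^ m @ [C1]) @ [A1, B1]) \<otimes>\<^sub>K s) =
      reduced_tensor ([C0] @ cab \<^bold>^ m @ [C1]) ([A1, B1] @ s)
      + reduced_tensor (([C0] @ cab \<^bold>^ m) @ [A0]) ([B0, C0] @ s)" for s
    by (rule B1_differential_extend_correction[OF B1_chain_odd_members(5)])
      (use inv B1_chain_odd_members(6)[of m] in \<open>simp_all add: tensors next_tail.intros\<close>)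
  ultimately show ?thesis
    by (simp add: even_formulas_def Let_def word_power_Suc[of cab m])
qed

lemma odd_formulas_hold: "odd_formulas TYPE('k::field) m"
proof (induction m)
  case 0
  show ?case by (rule odd_from_even[OF even_invariant_0])
next
  case (Suc m)
  show ?case by (rule odd_from_even[OF even_invariant_Suc[OF even_from_odd[OF Suc.IH]]])
qed

lemma even_formulas_hold: "even_formulas TYPE('k::field) m"
  by (rule even_from_odd[OF odd_formulas_hold])

theorem proposition4p4p2:
  fixes R :: "(B1_gen list \<Rightarrow>\<^sub>0 'k::field) set"
    and chains :: "nat \<Rightarrow> B1_gen list set"
    and d :: "nat \<Rightarrow> (B1_gen, 'k) chain_module \<Rightarrow> (B1_gen, 'k) chain_module"
  assumes "R = B1_relations"
    and "\<And>n. chains n = {w. anick_chain R B1_order n w}"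
    and "\<And>n. d n = anick_differential R B1_order n"
  shows "(\<forall>n m. n = 2 * m + 1 \<longrightarrow>
      chains n =
        {[A1, B1, C1] \<^bold>^ (m + 1), [C1, A1, B1] \<^bold>^ (m + 1), [B1, C1, A1] \<^bold>^ (m + 1),
         [B1, C1, A1] \<^bold>^ m @ [B1, A0],
         [C0] @ [C1, A1, B1] \<^bold>^ m @ [C1], [C0] @ [C1, A1, B1] \<^bold>^ m @ [A0]} \<and>
      d n (([A1, B1, C1] \<^bold>^ (m + 1)) \<otimes>\<^sub>K []) =
        ([A1, B1, C1] \<^bold>^ m @ [A1]) \<otimes>\<^sub>K [B1, C1] \<and>
      d n (([C1, A1, B1] \<^bold>^ (m + 1)) \<otimes>\<^sub>K []) =
        ([C1, A1, B1] \<^bold>^ m @ [C1]) \<otimes>\<^sub>K [A1, B1] +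
        ([C1, A1, B1] \<^bold>^ m @ [A0]) \<otimes>\<^sub>K [B0, C0] \<and>
      d n (([B1, C1, A1] \<^bold>^ (m + 1)) \<otimes>\<^sub>K []) =
        ([B1, C1, A1] \<^bold>^ m @ [B1]) \<otimes>\<^sub>K [C1, A1] \<and>
      d n (([B1, C1, A1] \<^bold>^ m @ [B1, A0]) \<otimes>\<^sub>K []) =
        ([B1, C1, A1] \<^bold>^ m @ [B1]) \<otimes>\<^sub>K [A0] \<and>
      d n (([C0] @ [C1, A1, B1] \<^bold>^ m @ [C1]) \<otimes>\<^sub>K []) =
        ([C0] @ [C1, A1, B1] \<^bold>^ m) \<otimes>\<^sub>K [C1] \<and>
      d n (([C0] @ [C1, A1, B1] \<^bold>^ m @ [A0]) \<otimes>\<^sub>K []) =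
        ([C0] @ [C1, A1, B1] \<^bold>^ m) \<otimes>\<^sub>K [A0]) \<and>
    (\<forall>n m. n = 2 * m \<and> m \<ge> 1 \<longrightarrow>
      chains n =
        {[A1, B1, C1] \<^bold>^ m @ [A1], [C1, A1, B1] \<^bold>^ m @ [C1], [C1, A1, B1] \<^bold>^ m @ [A0],
         [B1, C1, A1] \<^bold>^ m @ [B1], [C0] @ [C1, A1, B1] \<^bold>^ m} \<and>
      d n (([A1, B1, C1] \<^bold>^ m @ [A1]) \<otimes>\<^sub>K []) =
        ([A1, B1, C1] \<^bold>^ m) \<otimes>\<^sub>K [A1] \<and>
      d n (([C1, A1, B1] \<^bold>^ m @ [C1]) \<otimes>\<^sub>K []) =
        ([C1, A1, B1] \<^bold>^ m) \<otimes>\<^sub>K [C1] \<and>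
      d n (([C1, A1, B1] \<^bold>^ m @ [A0]) \<otimes>\<^sub>K []) =
        ([C1, A1, B1] \<^bold>^ m) \<otimes>\<^sub>K [A0] \<and>
      d n (([B1, C1, A1] \<^bold>^ m @ [B1]) \<otimes>\<^sub>K []) =
        ([B1, C1, A1] \<^bold>^ m) \<otimes>\<^sub>K [B1] +
        ([B1, C1, A1] \<^bold>^ (m - 1) @ [B1, A0]) \<otimes>\<^sub>K [B0, C0] \<and>
      d n (([C0] @ [C1, A1, B1] \<^bold>^ m) \<otimes>\<^sub>K []) =
        ([C0] @ [C1, A1, B1] \<^bold>^ (m - 1) @ [C1]) \<otimes>\<^sub>K [A1, B1] +
        ([C0] @ [C1, A1, B1] \<^bold>^ (m - 1) @ [A0]) \<otimes>\<^sub>K [B0, C0])"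
proof -
  have normal: "B1_normal [B1, C1]" "B1_normal [A1, B1]" "B1_normal [B0, C0]" "B1_normal [C1, A1]"
    "B1_normal [x]" for x
    by (simp_all add: B1_normal_Cons B1_leading_words_def)
  note tensors = normal[THEN reduced_tensor_normal]
  have chains_eq: "chains n = {w. \<exists>t. B1_chain n w t}" for n
    using assms(1,2) by simp
  have d_eq: "d n = B1_differential n" for n
    using assms(1,3) by simp
  have odd_set: "chains (Suc (2 * m)) = fst ` odd_chains m" for m
    by (force simp: chains_eq B1_chain_odd)
  have even_set: "chains (2 * m) = fst ` even_chains m" for m
    by (force simp: chains_eq B1_chain_even)
  show ?thesis
  proof (rule conjI, goal_cases)
    case 1
    show ?case
    proof (intro allI impI, goal_cases)
      case (1 n m)
      show ?case
        using odd_formulas_hold[of m, where 'k = 'k, unfolded odd_formulas_def Let_def, THEN spec[of _ "[]"]]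
        unfolding 1 by (simp add: odd_set odd_chains_def d_eq tensors)
    qed
  next
    case 2
    show ?case
    proof (intro allI impI, goal_cases)
      case (1 n m)
      then obtain l where m: "m = Suc l" and n: "n = 2 * m" by (cases m) auto
      show ?case
        using even_formulas_hold[of l, where 'k = 'k, unfolded even_formulas_def Let_def, THEN spec[of _ "[]"]]
        unfolding n even_set m by (simp add: even_chains_def d_eq tensors)
    qed
  qed
qed

end
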